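(* Let $p$ be a prime number, and let $(G,\theta)$ be a pro-$p$ group with cyclotomic orientation. (i) If $p$ is odd, then $G$ has no $p$-torsion. (ii) If $p=2$, then every non-trivial $2$-torsion subgroup of $G$ is isomorphic to $C_2$, the cyclic group of order $2$. Moreover, if $\mathrm{im}(\theta)$ has no $2$-torsion, then $G$ has no $2$-torsion.
   Context: Subgroups are closed. An orientation of a pro-$p$ group $G$ is a continuous homomorphism $\theta\colon G\to\mathbb{Z}_p^\times$; $\mathbb{Z}_p(1)$ denotes $\mathbb{Z}_p$ with the $G$-action $g.\lambda=\theta(g)\lambda$. A Bloch-Kato pro-$p$ group is a pro-$p$ group $G$ such that for every closed subgroup $C\le G$ the cohomology ring $H^\bullet(C,\mathbb{F}_p)$ (with cup product) is a quadratic $\mathbb{F}_p$-algebra, i.e., generated in degree 1 with ideal of relations generated in degree 2. The orientation $\theta$ is cyclotomic if $G$ is Bloch-Kato and $H^2(C,\mathbb{Z}_p(1))$ (continuous cochain cohomology) is torsion-free for all closed subgroups $C$ of $G$. *)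

theory Defs
  imports
    "HOL-Analysis.Function_Topology"
    "HOL-Analysis.Product_Topology"
    "HOL-Analysis.T1_Spaces"
    "HOL-Algebra.Elementary_Groups"
    "HOL-Algebra.QuotRing"
    "HOL-Algebra.Module"
    "HOL-Number_Theory.Residues"
begin

section \<open>Pro-$p$ groups and torsion\<close>

definition topological_group :: "('g, 'b) monoid_scheme \<Rightarrow> 'g topology \<Rightarrow> bool"
  where "topological_group G T \<longleftrightarrow>
    group G \<and> topspace T = carrier G \<and>
    continuous_map (prod_topology T T) T (\<lambda>(x, y). x \<otimes>\<^bsub>G\<^esub> y) \<and>
    continuous_map T T (\<lambda>x. inv\<^bsub>G\<^esub> x)"

definition profinite_group :: "('g, 'b) monoid_scheme \<Rightarrow> 'g topology \<Rightarrow> bool"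
  where "profinite_group G T \<longleftrightarrow>
    topological_group G T \<and> compact_space T \<and> Hausdorff_space T \<and>
    (\<forall>S. connectedin T S \<longrightarrow> (\<exists>a. S \<subseteq> {a}))"

definition pro_p_group :: "nat \<Rightarrow> ('g, 'b) monoid_scheme \<Rightarrow> 'g topology \<Rightarrow> bool"
  where "pro_p_group p G T \<longleftrightarrow>
    profinite_group G T \<and>
    (\<forall>N. normal N G \<and> openin T N \<longrightarrow> (\<exists>k. order (G Mod N) = p ^ k))"

definition closed_subgroup :: "'g set \<Rightarrow> ('g, 'b) monoid_scheme \<Rightarrow> 'g topology \<Rightarrow> bool"
  where "closed_subgroup H G T \<longleftrightarrow> subgroup H G \<and> closedin T H"

definition p_torsion_elements :: "nat \<Rightarrow> ('g, 'b) monoid_scheme \<Rightarrow> 'g set"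
  where "p_torsion_elements p G = {g \<in> carrier G. \<exists>k::nat. g [^]\<^bsub>G\<^esub> (p ^ k) = \<one>\<^bsub>G\<^esub>}"

definition p_torsion_group :: "nat \<Rightarrow> ('g, 'b) monoid_scheme \<Rightarrow> bool"
  where "p_torsion_group p G \<longleftrightarrow> p_torsion_elements p G = carrier G"

definition no_p_torsion :: "nat \<Rightarrow> ('g, 'b) monoid_scheme \<Rightarrow> bool"
  where "no_p_torsion p G \<longleftrightarrow> p_torsion_elements p G = {\<one>\<^bsub>G\<^esub>}"

definition torsion_free_group :: "('g, 'b) monoid_scheme \<Rightarrow> bool"
  where "torsion_free_group G \<longleftrightarrow>
    (\<forall>g \<in> carrier G. \<forall>n::nat. 0 < n \<and> g [^]\<^bsub>G\<^esub> n = \<one>\<^bsub>G\<^esub> \<longrightarrow> g = \<one>\<^bsub>G\<^esub>)"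


section \<open>The ring of $p$-adic integers\<close>

text \<open>The inverse limit of the rings of integers modulo \<open>p ^ n\<close>: the entry with index \<open>n\<close> of a
  compatible sequence is the representative in \<open>{0..<p ^ n}\<close> of its residue class.\<close>

definition Zp :: "nat \<Rightarrow> (nat \<Rightarrow> int) ring"
  where "Zp p =
    \<lparr>carrier = {x. \<forall>n. x n \<in> {0..<int p ^ n} \<and> x (Suc n) mod int p ^ n = x n},
     monoid.mult = (\<lambda>x y n. (x n * y n) mod int p ^ n),
     one = (\<lambda>n. 1 mod int p ^ n),
     ring.zero = (\<lambda>n. 0),
     add = (\<lambda>x y n. (x n + y n) mod int p ^ n)\<rparr>"

definition Zp_topology :: "nat \<Rightarrow> (nat \<Rightarrow> int) topology"
  where "Zp_topology p =
    subtopology (product_topology (\<lambda>_. discrete_topology UNIV) UNIV) (carrier (Zp p))"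

definition orientation ::
    "nat \<Rightarrow> ('g, 'b) monoid_scheme \<Rightarrow> 'g topology \<Rightarrow> ('g \<Rightarrow> nat \<Rightarrow> int) \<Rightarrow> bool"
  where "orientation p G T \<theta> \<longleftrightarrow>
    \<theta> \<in> hom G (units_of (Zp p)) \<and>
    continuous_map T (subtopology (Zp_topology p) (Units (Zp p))) \<theta>"


section \<open>Continuous cochain cohomology\<close>

text \<open>Throughout, \<open>G\<close> is a group with topology \<open>T\<close>, and the coefficients are the additive group of
  \<open>M\<close> with topology \<open>TM\<close> and left \<open>G\<close>-action \<open>act\<close>. An \<open>n\<close>-tuple of elements of \<open>G\<close> is a function
  on \<open>nat\<close> which is \<open>undefined\<close> outside \<open>{..<n}\<close>; for \<open>n = 0\<close> there is exactly one.\<close>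

definition tuples :: "('g, 'b) monoid_scheme \<Rightarrow> nat \<Rightarrow> (nat \<Rightarrow> 'g) set"
  where "tuples G n = (\<Pi>\<^sub>E i\<in>{..<n}. carrier G)"

definition cochains ::
    "('g, 'b) monoid_scheme \<Rightarrow> 'g topology \<Rightarrow> ('m, 'c) ring_scheme \<Rightarrow> 'm topology \<Rightarrow> nat
      \<Rightarrow> ((nat \<Rightarrow> 'g) \<Rightarrow> 'm) set"
  where "cochains G T M TM n =
    {f \<in> tuples G n \<rightarrow>\<^sub>E carrier M. continuous_map (product_topology (\<lambda>_. T) {..<n}) TM f}"

text \<open>The inhomogeneous differential: the value at \<open>(x 0, \<dots>, x n)\<close> is
  \<open>x 0 \<cdot> f (x 1, \<dots>, x n) + (\<Sum>j<n. (-1)^(j+1) f (x 0, \<dots>, x j * x (j+1), \<dots>, x n))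
    + (-1)^(n+1) f (x 0, \<dots>, x (n-1))\<close>.\<close>

definition coboundary_map ::
    "('g, 'b) monoid_scheme \<Rightarrow> ('m, 'c) ring_scheme \<Rightarrow> ('g \<Rightarrow> 'm \<Rightarrow> 'm) \<Rightarrow> nat
      \<Rightarrow> ((nat \<Rightarrow> 'g) \<Rightarrow> 'm) \<Rightarrow> (nat \<Rightarrow> 'g) \<Rightarrow> 'm"
  where "coboundary_map G M act n f =
    (\<lambda>x \<in> tuples G (Suc n).
       act (x 0) (f (\<lambda>i\<in>{..<n}. x (Suc i)))
       \<oplus>\<^bsub>M\<^esub> (\<Oplus>\<^bsub>M\<^esub>j\<in>{..<n}. [((-1) ^ Suc j :: int)] \<cdot>\<^bsub>M\<^esub>
             f (\<lambda>i\<in>{..<n}. if i < j then x i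
                           else if i = j then x j \<otimes>\<^bsub>G\<^esub> x (Suc j)
                           else x (Suc i)))
       \<oplus>\<^bsub>M\<^esub> [((-1) ^ Suc n :: int)] \<cdot>\<^bsub>M\<^esub> f (\<lambda>i\<in>{..<n}. x i))"

definition cocycle_group ::
    "('g, 'b) monoid_scheme \<Rightarrow> 'g topology \<Rightarrow> ('m, 'c) ring_scheme \<Rightarrow> 'm topology
      \<Rightarrow> ('g \<Rightarrow> 'm \<Rightarrow> 'm) \<Rightarrow> nat \<Rightarrow> ((nat \<Rightarrow> 'g) \<Rightarrow> 'm) monoid"
  where "cocycle_group G T M TM act n =
    \<lparr>carrier = {f \<in> cochains G T M TM n.
        coboundary_map G M act n f = (\<lambda>x \<in> tuples G (Suc n). \<zero>\<^bsub>M\<^esub>)},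
     monoid.mult = (\<lambda>f g. \<lambda>x \<in> tuples G n. f x \<oplus>\<^bsub>M\<^esub> g x),
     one = (\<lambda>x \<in> tuples G n. \<zero>\<^bsub>M\<^esub>)\<rparr>"

definition coboundaries ::
    "('g, 'b) monoid_scheme \<Rightarrow> 'g topology \<Rightarrow> ('m, 'c) ring_scheme \<Rightarrow> 'm topology
      \<Rightarrow> ('g \<Rightarrow> 'm \<Rightarrow> 'm) \<Rightarrow> nat \<Rightarrow> ((nat \<Rightarrow> 'g) \<Rightarrow> 'm) set"
  where "coboundaries G T M TM act n =
    (case n of 0 \<Rightarrow> {\<lambda>x \<in> tuples G 0. \<zero>\<^bsub>M\<^esub>}
     | Suc m \<Rightarrow> coboundary_map G M act m ` cochains G T M TM m)"

text \<open>As with the homology groups of \<open>HOL-Homology\<close>, this abelian group is written multiplicatively.\<close>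

definition cohomology_group ::
    "('g, 'b) monoid_scheme \<Rightarrow> 'g topology \<Rightarrow> ('m, 'c) ring_scheme \<Rightarrow> 'm topology
      \<Rightarrow> ('g \<Rightarrow> 'm \<Rightarrow> 'm) \<Rightarrow> nat \<Rightarrow> ((nat \<Rightarrow> 'g) \<Rightarrow> 'm) set monoid"
  where "cohomology_group G T M TM act n =
    cocycle_group G T M TM act n Mod coboundaries G T M TM act n"


section \<open>The cohomology algebra with trivial coefficients\<close>

text \<open>\<open>K\<close> is a discrete commutative ring with trivial action.\<close>

abbreviation triv_cocycles ::
    "('k, 'm) ring_scheme \<Rightarrow> ('g, 'b) monoid_scheme \<Rightarrow> 'g topology \<Rightarrow> nat
      \<Rightarrow> ((nat \<Rightarrow> 'g) \<Rightarrow> 'k) monoid"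
  where "triv_cocycles K G T n \<equiv> cocycle_group G T K (discrete_topology (carrier K)) (\<lambda>g a. a) n"

abbreviation triv_cohomology ::
    "('k, 'm) ring_scheme \<Rightarrow> ('g, 'b) monoid_scheme \<Rightarrow> 'g topology \<Rightarrow> nat
      \<Rightarrow> ((nat \<Rightarrow> 'g) \<Rightarrow> 'k) set monoid"
  where "triv_cohomology K G T n \<equiv>
    cohomology_group G T K (discrete_topology (carrier K)) (\<lambda>g a. a) n"

definition cohomology_class ::
    "('k, 'm) ring_scheme \<Rightarrow> ('g, 'b) monoid_scheme \<Rightarrow> 'g topology \<Rightarrow> nat
      \<Rightarrow> ((nat \<Rightarrow> 'g) \<Rightarrow> 'k) \<Rightarrow> ((nat \<Rightarrow> 'g) \<Rightarrow> 'k) set"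
  where "cohomology_class K G T n f =
    coboundaries G T K (discrete_topology (carrier K)) (\<lambda>g a. a) n #>\<^bsub>triv_cocycles K G T n\<^esub> f"

definition cochain_cup ::
    "('k, 'm) ring_scheme \<Rightarrow> ('g, 'b) monoid_scheme \<Rightarrow> nat \<Rightarrow> nat
      \<Rightarrow> ((nat \<Rightarrow> 'g) \<Rightarrow> 'k) \<Rightarrow> ((nat \<Rightarrow> 'g) \<Rightarrow> 'k) \<Rightarrow> (nat \<Rightarrow> 'g) \<Rightarrow> 'k"
  where "cochain_cup K G i j f g =
    (\<lambda>x \<in> tuples G (i + j). f (\<lambda>l\<in>{..<i}. x l) \<otimes>\<^bsub>K\<^esub> g (\<lambda>l\<in>{..<j}. x (i + l)))"

text \<open>As for \<^const>\<open>rcoset_mult\<close>, an operation on classes is the union over all representatives.\<close>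

definition cup ::
    "('k, 'm) ring_scheme \<Rightarrow> ('g, 'b) monoid_scheme \<Rightarrow> 'g topology \<Rightarrow> nat \<Rightarrow> nat
      \<Rightarrow> ((nat \<Rightarrow> 'g) \<Rightarrow> 'k) set \<Rightarrow> ((nat \<Rightarrow> 'g) \<Rightarrow> 'k) set \<Rightarrow> ((nat \<Rightarrow> 'g) \<Rightarrow> 'k) set"
  where "cup K G T i j \<xi> \<eta> =
    (\<Union>f\<in>\<xi>. \<Union>g\<in>\<eta>. cohomology_class K G T (i + j) (cochain_cup K G i j f g))"

text \<open>The direct sum of the cohomology groups; \<open>x n\<close> is the component of \<open>x\<close> in degree \<open>n\<close>.\<close>

definition cohomology_algebra ::
    "('k, 'm) ring_scheme \<Rightarrow> ('g, 'b) monoid_scheme \<Rightarrow> 'g topology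
      \<Rightarrow> ('k, nat \<Rightarrow> ((nat \<Rightarrow> 'g) \<Rightarrow> 'k) set) module"
  where "cohomology_algebra K G T =
    \<lparr>carrier = {x. (\<forall>n. x n \<in> carrier (triv_cohomology K G T n)) \<and>
                   finite {n. x n \<noteq> \<one>\<^bsub>triv_cohomology K G T n\<^esub>}},
     monoid.mult = (\<lambda>x y n. \<Otimes>\<^bsub>triv_cohomology K G T n\<^esub>i\<in>{..n}. cup K G T i (n - i) (x i) (y (n - i))),
     one = (\<lambda>n. if n = 0 then cohomology_class K G T 0 (\<lambda>x \<in> tuples G 0. \<one>\<^bsub>K\<^esub>)
                else \<one>\<^bsub>triv_cohomology K G T n\<^esub>),
     ring.zero = (\<lambda>n. \<one>\<^bsub>triv_cohomology K G T n\<^esub>),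
     add = (\<lambda>x y n. x n \<otimes>\<^bsub>triv_cohomology K G T n\<^esub> y n),
     smult = (\<lambda>c x n. \<Union>f\<in>x n. cohomology_class K G T n (\<lambda>t \<in> tuples G n. c \<otimes>\<^bsub>K\<^esub> f t))\<rparr>"

definition cohomology_degree ::
    "('k, 'm) ring_scheme \<Rightarrow> ('g, 'b) monoid_scheme \<Rightarrow> 'g topology \<Rightarrow> nat
      \<Rightarrow> (nat \<Rightarrow> ((nat \<Rightarrow> 'g) \<Rightarrow> 'k) set) set"
  where "cohomology_degree K G T n =
    {x \<in> carrier (cohomology_algebra K G T).
       \<forall>m. m \<noteq> n \<longrightarrow> x m = \<one>\<^bsub>triv_cohomology K G T m\<^esub>}"


section \<open>Tensor algebras and quadratic algebras\<close>

text \<open>Noncommutative polynomials over \<open>K\<close> in the variables \<open>S\<close>, as finitely supported functions on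
  the words over \<open>S\<close>.\<close>

definition free_algebra :: "('k, 'm) ring_scheme \<Rightarrow> 'x set \<Rightarrow> ('x list \<Rightarrow> 'k) ring"
  where "free_algebra K S =
    \<lparr>carrier = {f. (\<forall>w. f w \<in> carrier K) \<and> finite {w. f w \<noteq> \<zero>\<^bsub>K\<^esub>} \<and>
                   {w. f w \<noteq> \<zero>\<^bsub>K\<^esub>} \<subseteq> lists S},
     monoid.mult = (\<lambda>f g w. \<Oplus>\<^bsub>K\<^esub>i\<in>{..length w}. f (take i w) \<otimes>\<^bsub>K\<^esub> g (drop i w)),
     one = (\<lambda>w. if w = [] then \<one>\<^bsub>K\<^esub> else \<zero>\<^bsub>K\<^esub>),
     ring.zero = (\<lambda>w. \<zero>\<^bsub>K\<^esub>),
     add = (\<lambda>f g w. f w \<oplus>\<^bsub>K\<^esub> g w)\<rparr>"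

definition free_monom :: "('k, 'm) ring_scheme \<Rightarrow> 'k \<Rightarrow> 'x list \<Rightarrow> 'x list \<Rightarrow> 'k"
  where "free_monom K c w = (\<lambda>u. if u = w then c else \<zero>\<^bsub>K\<^esub>)"

text \<open>The tensor algebra of a \<open>K\<close>-module \<open>V\<close> is the free algebra on the set \<open>V\<close> modulo the relations
  making the inclusion of \<open>V\<close> linear. (\<^const>\<open>genideal\<close> generates two-sided ideals.)\<close>

definition tensor_ideal ::
    "('k, 'm) ring_scheme \<Rightarrow> ('k, 'v, 'c) module_scheme \<Rightarrow> ('v list \<Rightarrow> 'k) set"
  where "tensor_ideal K V = Idl\<^bsub>free_algebra K (carrier V)\<^esub>
    ({free_monom K \<one>\<^bsub>K\<^esub> [v \<oplus>\<^bsub>V\<^esub> w] \<ominus>\<^bsub>free_algebra K (carrier V)\<^esub>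
        (free_monom K \<one>\<^bsub>K\<^esub> [v] \<oplus>\<^bsub>free_algebra K (carrier V)\<^esub> free_monom K \<one>\<^bsub>K\<^esub> [w])
        | v w. v \<in> carrier V \<and> w \<in> carrier V} \<union>
     {free_monom K \<one>\<^bsub>K\<^esub> [c \<odot>\<^bsub>V\<^esub> v] \<ominus>\<^bsub>free_algebra K (carrier V)\<^esub> free_monom K c [v]
        | c v. c \<in> carrier K \<and> v \<in> carrier V})"

definition tensor_algebra ::
    "('k, 'm) ring_scheme \<Rightarrow> ('k, 'v, 'c) module_scheme \<Rightarrow> ('v list \<Rightarrow> 'k) set ring"
  where "tensor_algebra K V = free_algebra K (carrier V) Quot tensor_ideal K V"

definition tensor_class ::
    "('k, 'm) ring_scheme \<Rightarrow> ('k, 'v, 'c) module_scheme \<Rightarrow> ('v list \<Rightarrow> 'k) \<Rightarrow> ('v list \<Rightarrow> 'k) set"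
  where "tensor_class K V f = tensor_ideal K V +>\<^bsub>free_algebra K (carrier V)\<^esub> f"

definition tensor_degree ::
    "('k, 'm) ring_scheme \<Rightarrow> ('k, 'v, 'c) module_scheme \<Rightarrow> nat \<Rightarrow> ('v list \<Rightarrow> 'k) set set"
  where "tensor_degree K V n =
    {tensor_class K V f | f. f \<in> carrier (free_algebra K (carrier V)) \<and>
       (\<forall>w. f w \<noteq> \<zero>\<^bsub>K\<^esub> \<longrightarrow> length w = n)}"

text \<open>For a graded \<open>K\<close>-algebra \<open>A\<close> with homogeneous components \<open>gr n\<close>, the map \<open>\<phi>\<close> below is the
  canonical algebra homomorphism from the tensor algebra of \<open>gr 1\<close> to \<open>A\<close>; the first three
  conditions determine it uniquely. Surjectivity says that \<open>A\<close> is generated in degree 1, and the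
  kernel is the ideal of relations.\<close>

definition quadratic_algebra ::
    "('k, 'm) ring_scheme \<Rightarrow> ('k, 'a) module \<Rightarrow> (nat \<Rightarrow> 'a set) \<Rightarrow> bool"
  where "quadratic_algebra K A gr \<longleftrightarrow>
    (let V = A\<lparr>carrier := gr 1\<rparr>; TV = tensor_algebra K V in
     \<exists>\<phi>. \<phi> \<in> ring_hom TV A \<and>
         (\<forall>c\<in>carrier K. \<phi> (tensor_class K V (free_monom K c [])) = c \<odot>\<^bsub>A\<^esub> \<one>\<^bsub>A\<^esub>) \<and>
         (\<forall>v\<in>gr 1. \<phi> (tensor_class K V (free_monom K \<one>\<^bsub>K\<^esub> [v])) = v) \<and>
         \<phi> ` carrier TV = carrier A \<and>
         a_kernel TV A \<phi> = Idl\<^bsub>TV\<^esub> (a_kernel TV A \<phi> \<inter> tensor_degree K V 2))"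


section \<open>Cyclotomic orientations\<close>

abbreviation F_p :: "nat \<Rightarrow> int ring"
  where "F_p p \<equiv> residue_ring (int p)"

definition bloch_kato_pro_p_group :: "nat \<Rightarrow> ('g, 'b) monoid_scheme \<Rightarrow> 'g topology \<Rightarrow> bool"
  where "bloch_kato_pro_p_group p G T \<longleftrightarrow>
    pro_p_group p G T \<and>
    (\<forall>C. closed_subgroup C G T \<longrightarrow>
       quadratic_algebra (F_p p)
         (cohomology_algebra (F_p p) (G\<lparr>carrier := C\<rparr>) (subtopology T C))
         (cohomology_degree (F_p p) (G\<lparr>carrier := C\<rparr>) (subtopology T C)))"

text \<open>Cohomology with coefficients in \<open>\<int>\<^sub>p(1)\<close>, the $p$-adic integers with \<open>g\<close> acting as
  multiplication by \<open>\<theta> g\<close>.\<close>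

definition Zp1_cohomology ::
    "nat \<Rightarrow> ('g, 'b) monoid_scheme \<Rightarrow> 'g topology \<Rightarrow> ('g \<Rightarrow> nat \<Rightarrow> int) \<Rightarrow> nat
      \<Rightarrow> ((nat \<Rightarrow> 'g) \<Rightarrow> nat \<Rightarrow> int) set monoid"
  where "Zp1_cohomology p G T \<theta> n =
    cohomology_group G T (Zp p) (Zp_topology p) (\<lambda>g a. \<theta> g \<otimes>\<^bsub>Zp p\<^esub> a) n"

text \<open>The cohomology groups are \<open>\<int>\<^sub>p\<close>-modules, and every nonzero $p$-adic integer is a unit times
  a power of $p$, so torsion-freeness as modules and as abelian groups agree.\<close>

definition cyclotomic_orientation ::
    "nat \<Rightarrow> ('g, 'b) monoid_scheme \<Rightarrow> 'g topology \<Rightarrow> ('g \<Rightarrow> nat \<Rightarrow> int) \<Rightarrow> bool"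
  where "cyclotomic_orientation p G T \<theta> \<longleftrightarrow>
    orientation p G T \<theta> \<and> bloch_kato_pro_p_group p G T \<and>
    (\<forall>C. closed_subgroup C G T \<longrightarrow>
       torsion_free_group (Zp1_cohomology p (G\<lparr>carrier := C\<rparr>) (subtopology T C) \<theta> 2))"

end

theory Submission
  imports Defs
begin

text \<open>If \<open>g\<close> has order \<open>p\<close> and \<open>\<theta> g = 1\<close>, then \<open>H\<^sup>2(\<langle>g\<rangle>, \<int>\<^sub>p(1))\<close> is \<open>\<int>\<^sub>p/p\<close>, generated by the class
  of the carry cocycle \<open>(g\<^sup>i, g\<^sup>j) \<mapsto> \<lfloor>(i + j)/p\<rfloor>\<close> with \<open>i, j < p\<close>, which contradicts torsion-freeness.
  For odd \<open>p\<close> the \<open>p\<close>-adic units contain no element of order \<open>p\<close>, so \<open>\<theta> g = 1\<close> is automatic. For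
  \<open>p = 2\<close> every involution must be mapped to \<open>-1\<close>; since \<open>-1\<close> is not a square there are no elements
  of order 4, and the product of two distinct commuting involutions would be an involution on which
  \<open>\<theta>\<close> is trivial. It suffices to look at \<open>\<theta>\<close> modulo 4.\<close>

section \<open>The $p$-adic integers\<close>

text \<open>Membership becomes a congruence between unreduced representatives, so closure under the
  ring operations follows from congruence rules.\<close>

lemma Zp_memI:
  assumes "0 < p" "\<And>n. a (Suc n) mod int p ^ n = a n mod int p ^ n"
  shows "(\<lambda>n. a n mod int p ^ n) \<in> carrier (Zp p)"
  using assms by (auto simp: Zp_def mod_mod_cancel)

lemma Zp_component: "x \<in> carrier (Zp p) \<Longrightarrow> x n mod int p ^ n = x n"
  by (simp add: Zp_def)

lemma Zp_compat: "x \<in> carrier (Zp p) \<Longrightarrow> x (Suc n) mod int p ^ n = x n mod int p ^ n"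
  by (auto simp: Zp_def)

lemma Zp_mult_closed:
  assumes "0 < p" "x \<in> carrier (Zp p)" "y \<in> carrier (Zp p)"
  shows "(\<lambda>n. (x n * y n) mod int p ^ n) \<in> carrier (Zp p)"
  using assms by (intro Zp_memI) (auto intro: mod_mult_cong Zp_compat)

lemma Zp_add_closed:
  assumes "0 < p" "x \<in> carrier (Zp p)" "y \<in> carrier (Zp p)"
  shows "(\<lambda>n. (x n + y n) mod int p ^ n) \<in> carrier (Zp p)"
  using assms by (intro Zp_memI) (auto intro: mod_add_cong Zp_compat)

lemma Zp_cring:
  assumes "0 < p"
  shows "cring (Zp p)"
proof (rule cringI)
  show "abelian_group (Zp p)"
  proof (rule abelian_groupI)
    fix x assume x: "x \<in> carrier (Zp p)"
    have "(\<lambda>n. (- x n) mod int p ^ n) \<in> carrier (Zp p)"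
      using assms x by (intro Zp_memI) (auto intro: mod_minus_cong Zp_compat)
    moreover have "(\<lambda>n. (- x n) mod int p ^ n) \<oplus>\<^bsub>Zp p\<^esub> x = \<zero>\<^bsub>Zp p\<^esub>"
      by (simp add: Zp_def mod_simps)
    ultimately show "\<exists>y\<in>carrier (Zp p). y \<oplus>\<^bsub>Zp p\<^esub> x = \<zero>\<^bsub>Zp p\<^esub>" by blast
  qed (use assms Zp_add_closed[OF assms] in \<open>auto simp: Zp_def mod_simps algebra_simps\<close>)
  show "comm_monoid (Zp p)"
  proof (rule comm_monoidI)
    show "\<one>\<^bsub>Zp p\<^esub> \<in> carrier (Zp p)"
      using Zp_memI[OF assms, of "\<lambda>_. 1"] by (simp add: Zp_def)
  qed (use assms Zp_mult_closed[OF assms] in \<open>auto simp: Zp_def mod_simps algebra_simps\<close>)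
qed (auto simp: Zp_def mod_simps algebra_simps)

lemma Zp_one: "\<one>\<^bsub>Zp p\<^esub> = (\<lambda>n. 1 mod int p ^ n)"
  by (simp add: Zp_def)

section \<open>Roots of unity of order p among the p-adic integers\<close>

lemma Zp_pow_component:
  assumes "x \<in> carrier (Zp p)"
  shows "(x [^]\<^bsub>units_of (Zp p)\<^esub> (k::nat)) n = x n ^ k mod int p ^ n"
  by (induction k) (simp_all add: nat_pow_def units_of_def Zp_def mod_simps mult.commute)

text \<open>The factor \<open>(a\<^sup>p - 1) / (a - 1)\<close> is exactly divisible by \<open>p\<close> once.\<close>

lemma geometric_sum_mod:
  fixes a :: int
  assumes "[a = 1] (mod int p)" "odd p \<or> [a = 1] (mod int p ^ 2)"
  shows "[(\<Sum>i<p. a ^ i) = int p] (mod int p ^ 2)"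
proof -
  obtain u where u: "a = 1 + int p * u"
    using assms(1) by (metis cong_iff_lin cong_sym mult.commute)
  \<comment> \<open>Binomial expansion of \<open>(1 + p * u) ^ i\<close>, truncated after the linear
    term.\<close>
  have pow: "[a ^ i = 1 + int i * (int p * u)] (mod int p ^ 2)" for i
  proof (induction i)
    case (Suc i)
    have "[a ^ Suc i = (1 + int p * u) * (1 + int i * (int p * u))] (mod int p ^ 2)"
      using Suc u by (simp add: cong_scalar_left)
    also have "(1 + int p * u) * (1 + int i * (int p * u))
        = (1 + int (Suc i) * (int p * u)) + int p ^ 2 * (int i * u * u)"
      by (simp add: algebra_simps power2_eq_square)
    also have "[\<dots> = 1 + int (Suc i) * (int p * u)] (mod int p ^ 2)"
      by (simp add: cong_def)
    finally show ?case .
  qed simp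
  have "[(\<Sum>i<p. a ^ i) = (\<Sum>i<p. 1 + int i * (int p * u))] (mod int p ^ 2)"
    by (intro cong_sum pow)
  also have "(\<Sum>i<p. 1 + int i * (int p * u)) = int p + (\<Sum>i<p. int i) * (int p * u)"
    by (simp add: sum.distrib sum_distrib_right)
  also have "[\<dots> = int p] (mod int p ^ 2)"
  proof -
    \<comment> \<open>The cross term is \<open>p * u\<close> times p(p-1)/2. For odd
      \<open>p\<close> the second factor is itself a multiple of \<open>p\<close>; otherwise
      \<open>p * u = a - 1\<close> is already divisible by \<open>p ^ 2\<close>.\<close>
    have "int p ^ 2 dvd (\<Sum>i<p. int i) * (int p * u)" using assms(2)
    proof
      assume "odd p"
      then obtain m where m: "p = Suc (2 * m)" by (auto elim: oddE)
      have "2 * (\<Sum>i<n. int i) = int n * (int n - 1)" for n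
        by (induction n) (auto simp: algebra_simps)
      from this[of p] have "(\<Sum>i<p. int i) = int p * int m" by (simp add: m)
      then show ?thesis by (simp add: power2_eq_square)
    next
      assume "[a = 1] (mod int p ^ 2)"
      then have "int p ^ 2 dvd int p * u" by (simp add: cong_iff_dvd_diff u)
      then show ?thesis by (rule dvd_mult)
    qed
    then show ?thesis by (simp add: cong_iff_dvd_diff)
  qed
  finally show ?thesis .
qed

text \<open>Factor \<open>x ^ p - 1\<close> as \<open>x - 1\<close> times the geometric sum, which
  contains exactly one factor \<open>p\<close>. Hence divisibility of \<open>x ^ p - 1\<close> by
  every power of \<open>p\<close> passes to \<open>x - 1\<close>. For \<open>p = 2\<close> the
  condition \<open>x 2 = 1\<close>, that is x = 1 modulo 4, excludes the root -1.\<close>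

lemma Zp_pow_p_eq_one:
  assumes p: "prime p" and x: "x \<in> carrier (Zp p)"
    and pow: "x [^]\<^bsub>units_of (Zp p)\<^esub> p = \<one>\<^bsub>Zp p\<^esub>"
    and "odd p \<or> x 2 = 1"
  shows "x = \<one>\<^bsub>Zp p\<^esub>"
proof
  have pown: "int p ^ n dvd x n ^ p - 1" for n
    using fun_cong[OF pow, of n] by (simp add: Zp_pow_component[OF x] Zp_one mod_eq_dvd_iff)
  have low: "x (n + k) mod int p ^ n = x n" for n k
  proof (induction k)
    case (Suc k)
    have "x (n + Suc k) mod int p ^ n = x (Suc (n + k)) mod int p ^ (n + k) mod int p ^ n"
      by (simp add: mod_mod_cancel le_imp_power_dvd)
    also have "\<dots> = x (n + k) mod int p ^ n" using x by (simp add: Zp_def)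
    finally show ?case using Suc by simp
  qed (use Zp_component[OF x] in simp)
  \<comment> \<open>By Fermat, \<open>x ^ p\<close> is congruent to \<open>x\<close> modulo
    \<open>p\<close>, and it is also congruent to 1.\<close>
  have x1: "x 1 = 1"
  proof -
    have dvd: "int p dvd x 1 ^ p - 1" using pown[of 1] by simp
    define m where "m = nat (x 1)"
    have m: "x 1 = int m" using x by (simp add: Zp_def m_def)
    have "\<not> p dvd m"
    proof
      assume "p dvd m"
      then have "int p dvd x 1 ^ p"
        unfolding m using prime_gt_0_nat[OF p] by (simp add: dvd_trans[OF _ dvd_power])
      from dvd_diff[OF this dvd] have "int p dvd 1" by simp
      then show False using prime_gt_1_nat[OF p] by simp
    qed
    from fermat_theorem[OF p this] have "[int m ^ (p - 1) = 1] (mod int p)"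
      by (metis cong_int_iff of_nat_1 of_nat_power)
    then have "[int m * int m ^ (p - 1) = int m * 1] (mod int p)" by (rule cong_scalar_left)
    then have "[x 1 ^ p = x 1] (mod int p)"
      unfolding m using prime_gt_0_nat[OF p] by (simp flip: power_Suc)
    moreover have "[x 1 ^ p = 1] (mod int p)" using dvd by (simp add: cong_iff_dvd_diff)
    ultimately have "[x 1 = 1] (mod int p)" by (metis cong_sym cong_trans)
    then show ?thesis using Zp_component[OF x, of 1] prime_gt_1_nat[OF p] by (simp add: cong_def)
  qed
  fix n
  show "x n = \<one>\<^bsub>Zp p\<^esub> n"
  proof (cases n)
    case 0
    then show ?thesis using Zp_component[OF x, of 0] by (simp add: Zp_one)
  next
    case (Suc m)
    \<comment> \<open>One level above \<open>n\<close>, since the geometric sum costs one factor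
      \<open>p\<close>. As \<open>n = Suc m\<close>, the level is at least 2, so the hypothesis on
      \<open>x 2\<close> carries over to \<open>a\<close>.\<close>
    define a where "a = x (Suc n)"
    have "[a = 1] (mod int p)"
      using low[of 1 n] x1 prime_gt_1_nat[OF p] by (simp add: a_def cong_def)
    moreover have "odd p \<or> [a = 1] (mod int p ^ 2)"
      using low[of 2 m] Suc assms(4) prime_gt_1_nat[OF p] 
      by (auto simp: a_def cong_def)
    ultimately have "[(\<Sum>i<p. a ^ i) = int p] (mod int p ^ 2)" by (rule geometric_sum_mod)
    then obtain w where "(\<Sum>i<p. a ^ i) - int p = int p ^ 2 * w"
      unfolding cong_iff_dvd_diff by blast
    then have w: "(\<Sum>i<p. a ^ i) = int p * (1 + int p * w)"
      by (simp add: algebra_simps power2_eq_square)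
    have "int p ^ Suc n dvd (a - 1) * (\<Sum>i<p. a ^ i)"
      using pown[of "Suc n"] by (simp only: a_def power_diff_1_eq)
    then have "int p ^ n dvd (a - 1) * (1 + int p * w)"
      using prime_gt_0_nat[OF p] by (simp add: w mult.left_commute)
    \<comment> \<open>The cofactor left after removing the single \<open>p\<close> is 1 modulo
      \<open>p\<close>, so it can be cancelled.\<close>
    moreover have "coprime (int p) (1 + int p * w)"
      by (rule coprimeI) (metis dvd_add_left_iff dvd_mult2)
    then have "coprime (int p ^ n) (1 + int p * w)" by simp
    ultimately have "int p ^ n dvd a - 1" by (simp add: coprime_dvd_mult_left_iff)
    then show ?thesis using low[of n 1] by (simp add: a_def Zp_one flip: mod_eq_dvd_iff)
  qed
qed

section \<open>The image of the integers in the p-adic integers\<close>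

text \<open>The carry cocycle and the cochain bounding its p-th multiple take values in this image,
  so their identities reduce to integer arithmetic.\<close>

definition Zp_of_int :: "nat \<Rightarrow> int \<Rightarrow> nat \<Rightarrow> int"
  where "Zp_of_int p m = (\<lambda>n. m mod int p ^ n)"

lemma Zp_of_int_closed: "0 < p \<Longrightarrow> Zp_of_int p m \<in> carrier (Zp p)"
  unfolding Zp_of_int_def by (rule Zp_memI) auto

lemma Zp_of_int_add: "Zp_of_int p a \<oplus>\<^bsub>Zp p\<^esub> Zp_of_int p b = Zp_of_int p (a + b)"
  by (simp add: Zp_of_int_def Zp_def mod_simps)

lemma Zp_zero: "\<zero>\<^bsub>Zp p\<^esub> = Zp_of_int p 0"
  by (simp add: Zp_of_int_def Zp_def)

lemma Zp_add_component: "(x \<oplus>\<^bsub>Zp p\<^esub> y) n = (x n + y n) mod int p ^ n"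
  by (simp add: Zp_def)

text \<open>The ring negative is given by a description; uniqueness of additive inverses identifies
  it with the componentwise one.\<close>

lemma Zp_minus_component:
  assumes "0 < p" "x \<in> carrier (Zp p)"
  shows "(\<ominus>\<^bsub>Zp p\<^esub> x) n = (- x n) mod int p ^ n"
proof -
  interpret cring "Zp p" using assms(1) by (rule Zp_cring)
  let ?y = "\<lambda>n. (- x n) mod int p ^ n"
  have "?y \<in> carrier (Zp p)"
    using assms by (intro Zp_memI) (auto intro: mod_minus_cong Zp_compat)
  moreover have "?y \<oplus>\<^bsub>Zp p\<^esub> x = \<zero>\<^bsub>Zp p\<^esub>" by (simp add: Zp_def mod_simps)
  ultimately have "\<ominus>\<^bsub>Zp p\<^esub> x = ?y" using assms(2) by (intro minus_equality)
  then show ?thesis by simp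
qed

lemma Zp_of_int_diff:
  assumes "0 < p"
  shows "Zp_of_int p a \<ominus>\<^bsub>Zp p\<^esub> Zp_of_int p b = Zp_of_int p (a - b)"
proof
  fix n
  show "(Zp_of_int p a \<ominus>\<^bsub>Zp p\<^esub> Zp_of_int p b) n = Zp_of_int p (a - b) n"
    unfolding a_minus_def Zp_add_component Zp_minus_component[OF assms Zp_of_int_closed[OF assms]]
    by (simp add: Zp_of_int_def mod_simps)
qed

lemma Zp_of_int_add_pow: "[k] \<cdot>\<^bsub>Zp p\<^esub> Zp_of_int p a = Zp_of_int p (int k * a)" for k :: nat
proof (induction k)
  case 0
  then show ?case by (simp add: add_pow_def nat_pow_def Zp_zero)
next
  case (Suc k)
  have "[Suc k] \<cdot>\<^bsub>Zp p\<^esub> Zp_of_int p a = [k] \<cdot>\<^bsub>Zp p\<^esub> Zp_of_int p a \<oplus>\<^bsub>Zp p\<^esub> Zp_of_int p a"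
    by (simp add: add_pow_def nat_pow_def)
  with Suc show ?case by (simp add: Zp_of_int_add algebra_simps)
qed

section \<open>Cohomology of finite groups in degree 2\<close>

text \<open>All cochains, with no continuity condition, as one ambient group in which cocycles form
  a kernel and coboundaries an image.\<close>

definition cochain_group ::
    "('g, 'b) monoid_scheme \<Rightarrow> ('m, 'c) ring_scheme \<Rightarrow> nat \<Rightarrow> ((nat \<Rightarrow> 'g) \<Rightarrow> 'm) monoid"
  where "cochain_group G M n =
    \<lparr>carrier = tuples G n \<rightarrow>\<^sub>E carrier M,
     monoid.mult = (\<lambda>f g. \<lambda>x \<in> tuples G n. f x \<oplus>\<^bsub>M\<^esub> g x),
     one = (\<lambda>x \<in> tuples G n. \<zero>\<^bsub>M\<^esub>)\<rparr>"

text \<open>Here \<open>G\<close> is the coefficient group of the locale, and \<open>H\<close>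
  supplies the tuples.\<close>

lemma (in abelian_group) comm_group_cochain_group: "comm_group (cochain_group H G n)"
proof (rule comm_groupI)
  fix f assume f: "f \<in> carrier (cochain_group H G n)"
  have "(\<lambda>x \<in> tuples H n. \<ominus> f x) \<in> carrier (cochain_group H G n)"
    using f by (auto simp: cochain_group_def)
  moreover have "(\<lambda>x \<in> tuples H n. \<ominus> f x) \<otimes>\<^bsub>cochain_group H G n\<^esub> f = \<one>\<^bsub>cochain_group H G n\<^esub>"
    using f by (auto simp: cochain_group_def intro!: restrict_ext l_neg)
  ultimately show "\<exists>g\<in>carrier (cochain_group H G n). g \<otimes>\<^bsub>cochain_group H G n\<^esub> f = \<one>\<^bsub>cochain_group H G n\<^esub>"
    by blast
next
  fix f assume "f \<in> carrier (cochain_group H G n)"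
  then show "\<one>\<^bsub>cochain_group H G n\<^esub> \<otimes>\<^bsub>cochain_group H G n\<^esub> f = f"
    by (intro extensionalityI[of _ "tuples H n"]) (auto simp: cochain_group_def PiE_iff)
qed (auto simp: cochain_group_def PiE_iff a_ac intro!: restrict_ext)

text \<open>A finite Hausdorff group is discrete, so every cochain is continuous, whatever the
  topology on the underlying set of \<open>M\<close>.\<close>

locale finite_group_module = group G + M: abelian_group M
  for G :: "('g, 'b) monoid_scheme" (structure) and M :: "('m, 'c) ring_scheme" +
  fixes T :: "'g topology" and TM :: "'m topology" and act :: "'g \<Rightarrow> 'm \<Rightarrow> 'm"
  assumes finite_carrier: "finite (carrier G)"
    and Hausdorff: "Hausdorff_space T"
    and topspace_group: "topspace T = carrier G"
    and topspace_module: "topspace TM = carrier M"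
    and act_closed: "\<lbrakk>x \<in> carrier G; a \<in> carrier M\<rbrakk> \<Longrightarrow> act x a \<in> carrier M"
    and act_add: "\<lbrakk>x \<in> carrier G; a \<in> carrier M; b \<in> carrier M\<rbrakk>
      \<Longrightarrow> act x (a \<oplus>\<^bsub>M\<^esub> b) = act x a \<oplus>\<^bsub>M\<^esub> act x b"
    and act_mult: "\<lbrakk>x \<in> carrier G; y \<in> carrier G; a \<in> carrier M\<rbrakk>
      \<Longrightarrow> act (x \<otimes> y) a = act x (act y a)"
begin

lemma tuples_nth: "x \<in> tuples G n \<Longrightarrow> i < n \<Longrightarrow> x i \<in> carrier G"
  by (auto simp: tuples_def)

lemma restrict_in_tuples: "(\<And>i. i < n \<Longrightarrow> x i \<in> carrier G) \<Longrightarrow> (\<lambda>i\<in>{..<n}. x i) \<in> tuples G n"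
  by (auto simp: tuples_def)

lemma cochains_eq: "cochains G T M TM n = tuples G n \<rightarrow>\<^sub>E carrier M"
proof -
  have top: "topspace (product_topology (\<lambda>_. T) {..<n}) = tuples G n"
    by (simp add: tuples_def topspace_group)
  have "product_topology (\<lambda>_. T) {..<n} = discrete_topology (tuples G n)"
  proof (rule finite_t1_space_imp_discrete_topology[OF top])
    show "finite (tuples G n)" by (simp add: tuples_def finite_PiE finite_carrier)
    show "t1_space (product_topology (\<lambda>_. T) {..<n})"
      by (simp add: Hausdorff_imp_t1_space Hausdorff_space_product_topology Hausdorff)
  qed
  then show ?thesis by (auto simp: cochains_def topspace_module)
qed

section \<open>The differential as a homomorphism\<close>

abbreviation "\<delta> \<equiv> coboundary_map G M act"

lemma face_in_tuples:
  assumes "x \<in> tuples G (Suc n)" "j < n"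
  shows "(\<lambda>i\<in>{..<n}. if i < j then x i else if i = j then x j \<otimes> x (Suc j) else x (Suc i)) \<in> tuples G n"
  using assms(2) by (intro restrict_in_tuples) (auto intro!: tuples_nth[OF assms(1)])

text \<open>Each term of the alternating sum is additive in the cochain, the first one by additivity
  of the action. Subgroup properties of cocycles and coboundaries then come from kernels and images
  of homomorphisms.\<close>

lemma coboundary_hom: "\<delta> n \<in> hom (cochain_group G M n) (cochain_group G M (Suc n))"
proof (rule homI)
  fix f assume f: "f \<in> carrier (cochain_group G M n)"
  then have f': "f t \<in> carrier M" if "t \<in> tuples G n" for t
    using that by (auto simp: cochain_group_def)
  show "\<delta> n f \<in> carrier (cochain_group G M (Suc n))"
  proof -
    have "(\<lambda>i\<in>{..<n}. x (Suc i)) \<in> tuples G n" "(\<lambda>i\<in>{..<n}. x i) \<in> tuples G n" "x 0 \<in> carrier G"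
      if "x \<in> tuples G (Suc n)" for x
      by (auto intro!: restrict_in_tuples tuples_nth[OF that])
    then show ?thesis
      unfolding coboundary_map_def cochain_group_def
      by (auto intro!: M.add.m_closed act_closed M.add.int_pow_closed M.finsum_closed f' face_in_tuples)
  qed
  fix g assume g: "g \<in> carrier (cochain_group G M n)"
  then have g': "g t \<in> carrier M" if "t \<in> tuples G n" for t
    using that by (auto simp: cochain_group_def)
  show "\<delta> n (f \<otimes>\<^bsub>cochain_group G M n\<^esub> g) = \<delta> n f \<otimes>\<^bsub>cochain_group G M (Suc n)\<^esub> \<delta> n g"
  proof
    fix x
    show "\<delta> n (f \<otimes>\<^bsub>cochain_group G M n\<^esub> g) x = (\<delta> n f \<otimes>\<^bsub>cochain_group G M (Suc n)\<^esub> \<delta> n g) x"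
    proof (cases "x \<in> tuples G (Suc n)")
      case x: True
      \<comment> \<open>The three kinds of faces of \<open>x\<close>: \<open>a\<close> drops the
        first entry, \<open>b j\<close> multiplies two neighbours, \<open>c\<close> drops the last
        entry.\<close>
      define a where "a = (\<lambda>i\<in>{..<n}. x (Suc i))"
      define b where "b j = (\<lambda>i\<in>{..<n}. if i < j then x i else if i = j then x j \<otimes> x (Suc j) else x (Suc i))" for j
      define c where "c = (\<lambda>i\<in>{..<n}. x i)"
      have mem: "a \<in> tuples G n" "c \<in> tuples G n" "\<And>j. j < n \<Longrightarrow> b j \<in> tuples G n"
        unfolding a_def b_def c_def
        by (auto intro!: restrict_in_tuples face_in_tuples[OF x] tuples_nth[OF x])
      have x0: "x 0 \<in> carrier G" using x by (rule tuples_nth) simp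
      have fin: "(\<Oplus>\<^bsub>M\<^esub>j\<in>{..<n}. [((-1) ^ Suc j :: int)] \<cdot>\<^bsub>M\<^esub> (f (b j) \<oplus>\<^bsub>M\<^esub> g (b j)))
        = (\<Oplus>\<^bsub>M\<^esub>j\<in>{..<n}. [((-1) ^ Suc j :: int)] \<cdot>\<^bsub>M\<^esub> f (b j))
          \<oplus>\<^bsub>M\<^esub> (\<Oplus>\<^bsub>M\<^esub>j\<in>{..<n}. [((-1) ^ Suc j :: int)] \<cdot>\<^bsub>M\<^esub> g (b j))" (is "?l = ?f \<oplus>\<^bsub>M\<^esub> ?g")
      proof -
        have "?l = (\<Oplus>\<^bsub>M\<^esub>j\<in>{..<n}. [((-1) ^ Suc j :: int)] \<cdot>\<^bsub>M\<^esub> f (b j)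
            \<oplus>\<^bsub>M\<^esub> [((-1) ^ Suc j :: int)] \<cdot>\<^bsub>M\<^esub> g (b j))"
          by (rule M.finsum_cong') (auto simp: M.add.int_pow_distrib f' g' mem simp del: power_Suc)
        also have "\<dots> = ?f \<oplus>\<^bsub>M\<^esub> ?g"
          by (rule M.finsum_addf) (auto simp: f' g' mem)
        finally show ?thesis .
      qed
      have **: "\<delta> n h x = act (x 0) (h a) \<oplus>\<^bsub>M\<^esub> (\<Oplus>\<^bsub>M\<^esub>j\<in>{..<n}. [((-1) ^ Suc j :: int)] \<cdot>\<^bsub>M\<^esub> h (b j))
          \<oplus>\<^bsub>M\<^esub> [((-1) ^ Suc n :: int)] \<cdot>\<^bsub>M\<^esub> h c" for h
        using x by (simp add: coboundary_map_def a_def b_def c_def)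
      have fg: "(f \<otimes>\<^bsub>cochain_group G M n\<^esub> g) t = f t \<oplus>\<^bsub>M\<^esub> g t" if "t \<in> tuples G n" for t
        using that by (simp add: cochain_group_def)
      have sum_fg: "(\<Oplus>\<^bsub>M\<^esub>j\<in>{..<n}. [((-1) ^ Suc j :: int)] \<cdot>\<^bsub>M\<^esub> (f \<otimes>\<^bsub>cochain_group G M n\<^esub> g) (b j))
        = (\<Oplus>\<^bsub>M\<^esub>j\<in>{..<n}. [((-1) ^ Suc j :: int)] \<cdot>\<^bsub>M\<^esub> (f (b j) \<oplus>\<^bsub>M\<^esub> g (b j)))"
        by (rule M.finsum_cong') (auto simp: fg mem f' g')
      have closed: "(\<Oplus>\<^bsub>M\<^esub>j\<in>{..<n}. [((-1) ^ Suc j :: int)] \<cdot>\<^bsub>M\<^esub> f (b j)) \<in> carrier M"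
        "(\<Oplus>\<^bsub>M\<^esub>j\<in>{..<n}. [((-1) ^ Suc j :: int)] \<cdot>\<^bsub>M\<^esub> g (b j)) \<in> carrier M"
        by (auto intro!: M.finsum_closed f' g' mem)
      have "\<delta> n (f \<otimes>\<^bsub>cochain_group G M n\<^esub> g) x = \<delta> n f x \<oplus>\<^bsub>M\<^esub> \<delta> n g x"
        unfolding ** sum_fg fin
        by (simp add: fg mem f' g' x0 act_add act_closed M.add.int_pow_distrib closed M.a_ac del: power_Suc)
      with x show ?thesis by (simp add: cochain_group_def)
    qed (simp add: cochain_group_def coboundary_map_def)
  qed
qed

lemma coboundary_group_hom: "group_hom (cochain_group G M n) (cochain_group G M (Suc n)) (\<delta> n)"
  using M.comm_group_cochain_group[of G] coboundary_hom
  by (simp add: group_hom_def group_hom_axioms_def comm_group.axioms(2))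

lemma cocycle_group_eq: "cocycle_group G T M TM act n =
    (cochain_group G M n)\<lparr>carrier := kernel (cochain_group G M n) (cochain_group G M (Suc n)) (\<delta> n)\<rparr>"
  by (simp add: cocycle_group_def cochains_eq kernel_def cochain_group_def)

lemma coboundaries_Suc: "coboundaries G T M TM act (Suc n) = \<delta> n ` carrier (cochain_group G M n)"
  by (simp add: coboundaries_def cochains_eq cochain_group_def)

section \<open>Explicit differentials of 1- and 2-cochains\<close>

definition pair_tuple :: "'g \<Rightarrow> 'g \<Rightarrow> nat \<Rightarrow> 'g"
  where "pair_tuple x y = (\<lambda>i\<in>{..<2}. if i = 0 then x else y)"

definition single_tuple :: "'g \<Rightarrow> nat \<Rightarrow> 'g"
  where "single_tuple x = (\<lambda>i\<in>{..<Suc 0}. x)"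

lemma single_tuple_in [simp]: "x \<in> carrier G \<Longrightarrow> single_tuple x \<in> tuples G (Suc 0)"
  by (auto simp: tuples_def single_tuple_def)

lemma pair_tuple_in [simp]: "x \<in> carrier G \<Longrightarrow> y \<in> carrier G \<Longrightarrow> pair_tuple x y \<in> tuples G 2"
  by (auto simp: tuples_def pair_tuple_def)

lemma tuples_2: "t \<in> tuples G 2 \<Longrightarrow> t = pair_tuple (t 0) (t 1)"
  by (rule extensionalityI[of _ "{..<2}"]) (auto simp: tuples_def pair_tuple_def PiE_iff less_2_cases_iff)

lemma act_zero: "x \<in> carrier G \<Longrightarrow> act x \<zero>\<^bsub>M\<^esub> = \<zero>\<^bsub>M\<^esub>"
  using act_add[of x "\<zero>\<^bsub>M\<^esub>" "\<zero>\<^bsub>M\<^esub>"] act_closed[of x "\<zero>\<^bsub>M\<^esub>"] by (simp add: M.add.r_cancel_one')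

lemma act_neg: "x \<in> carrier G \<Longrightarrow> a \<in> carrier M \<Longrightarrow> act x (\<ominus>\<^bsub>M\<^esub> a) = \<ominus>\<^bsub>M\<^esub> act x a"
  by (metis M.a_inv_closed M.l_neg M.minus_equality act_add act_closed act_zero)

lemma coboundary_1:
  assumes "h \<in> carrier (cochain_group G M (Suc 0))" "x \<in> carrier G" "y \<in> carrier G"
  shows "\<delta> (Suc 0) h (pair_tuple x y) =
    act x (h (single_tuple y)) \<ominus>\<^bsub>M\<^esub> h (single_tuple (x \<otimes> y)) \<oplus>\<^bsub>M\<^esub> h (single_tuple x)"
proof -
  have mem: "pair_tuple x y \<in> tuples G (Suc (Suc 0))"
    using pair_tuple_in[OF assms(2,3)] by (simp add: numeral_2_eq_2)
  have eq: "\<delta> (Suc 0) h (pair_tuple x y) = act (pair_tuple x y 0) (h (\<lambda>i\<in>{..<Suc 0}. pair_tuple x y (Suc i)))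
       \<oplus>\<^bsub>M\<^esub> (\<Oplus>\<^bsub>M\<^esub>j\<in>{..<Suc 0}. [((-1) ^ Suc j :: int)] \<cdot>\<^bsub>M\<^esub>
             h (\<lambda>i\<in>{..<Suc 0}. if i < j then pair_tuple x y i
                           else if i = j then pair_tuple x y j \<otimes> pair_tuple x y (Suc j)
                           else pair_tuple x y (Suc i)))
       \<oplus>\<^bsub>M\<^esub> [((-1) ^ Suc (Suc 0) :: int)] \<cdot>\<^bsub>M\<^esub> h (\<lambda>i\<in>{..<Suc 0}. pair_tuple x y i)"
    unfolding coboundary_map_def by (simp only: restrict_apply'[OF mem])
  \<comment> \<open>The faces of a pair: drop the first entry, multiply the two, drop the
    last.\<close>
  have "(\<lambda>i\<in>{..<Suc 0}. pair_tuple x y (Suc i)) = single_tuple y"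
    "(\<lambda>i\<in>{..<Suc 0}. if i < 0 then pair_tuple x y i
      else if i = 0 then pair_tuple x y 0 \<otimes> pair_tuple x y (Suc 0) else pair_tuple x y (Suc i)) = single_tuple (x \<otimes> y)"
    "(\<lambda>i\<in>{..<Suc 0}. pair_tuple x y i) = single_tuple x" "pair_tuple x y 0 = x"
    by (auto simp: pair_tuple_def single_tuple_def)
  moreover have "h (single_tuple z) \<in> carrier M" if "z \<in> carrier G" for z
    using assms that by (auto simp: cochain_group_def)
  ultimately show ?thesis
    using assms act_closed
    unfolding eq by (simp add: lessThan_Suc M.add.int_pow_neg a_minus_def del: restrict_apply)
qed

lemma coboundary_2:
  assumes f: "f \<in> carrier (cochain_group G M 2)" and t: "t \<in> tuples G 3"
  shows "\<delta> 2 f t =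
    act (t 0) (f (pair_tuple (t 1) (t 2))) \<ominus>\<^bsub>M\<^esub> f (pair_tuple (t 0 \<otimes> t 1) (t 2))
     \<oplus>\<^bsub>M\<^esub> f (pair_tuple (t 0) (t 1 \<otimes> t 2)) \<ominus>\<^bsub>M\<^esub> f (pair_tuple (t 0) (t 1))"
proof -
  have t': "t 0 \<in> carrier G" "t 1 \<in> carrier G" "t (Suc 0) \<in> carrier G" "t 2 \<in> carrier G" using t by (auto intro: tuples_nth)
  have mem: "t \<in> tuples G (Suc 2)" using t by (simp add: eval_nat_numeral)
  have eq: "\<delta> 2 f t = act (t 0) (f (\<lambda>i\<in>{..<2}. t (Suc i)))
       \<oplus>\<^bsub>M\<^esub> (\<Oplus>\<^bsub>M\<^esub>j\<in>{..<2}. [((-1) ^ Suc j :: int)] \<cdot>\<^bsub>M\<^esub>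
             f (\<lambda>i\<in>{..<2}. if i < j then t i
                           else if i = j then t j \<otimes> t (Suc j)
                           else t (Suc i)))
       \<oplus>\<^bsub>M\<^esub> [((-1) ^ Suc 2 :: int)] \<cdot>\<^bsub>M\<^esub> f (\<lambda>i\<in>{..<2}. t i)"
    unfolding coboundary_map_def by (simp only: restrict_apply'[OF mem])
  have "(\<lambda>i\<in>{..<2}. t (Suc i)) = pair_tuple (t 1) (t 2)"
    "(\<lambda>i\<in>{..<2}. if i < 0 then t i
      else if i = 0 then t 0 \<otimes> t (Suc 0) else t (Suc i)) = pair_tuple (t 0 \<otimes> t 1) (t 2)"
    "(\<lambda>i\<in>{..<2}. if i < Suc 0 then t i
      else if i = Suc 0 then t (Suc 0) \<otimes> t (Suc (Suc 0)) else t (Suc i)) = pair_tuple (t 0) (t 1 \<otimes> t 2)"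
    "(\<lambda>i\<in>{..<2}. t i) = pair_tuple (t 0) (t 1)"
    by (auto simp: pair_tuple_def less_2_cases_iff fun_eq_iff simp flip: numeral_2_eq_2)
  moreover have "f (pair_tuple x y) \<in> carrier M" if "x \<in> carrier G" "y \<in> carrier G" for x y
    using f that by (auto simp: cochain_group_def)
  moreover have "{..<2} = {0, Suc 0}" by auto
  ultimately show ?thesis
    using t t' act_closed
    unfolding eq by (simp add: M.add.int_pow_neg a_minus_def M.a_ac del: restrict_apply)
qed

text \<open>This case of d d = 0 places the 2-coboundaries among the 2-cocycles. The terms cancel in
  pairs, using associativity in the group and compatibility of the action with products.\<close>

lemma coboundary_coboundary:
  assumes h: "h \<in> carrier (cochain_group G M (Suc 0))"
  shows "\<delta> 2 (\<delta> (Suc 0) h) = \<one>\<^bsub>cochain_group G M 3\<^esub>"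
proof
  fix t
  show "\<delta> 2 (\<delta> (Suc 0) h) t = \<one>\<^bsub>cochain_group G M 3\<^esub> t"
  proof (cases "t \<in> tuples G 3")
    case t: True
    have t': "t 0 \<in> carrier G" "t 1 \<in> carrier G" "t 2 \<in> carrier G" using t by (auto intro: tuples_nth)
    have h': "h (single_tuple x) \<in> carrier M" if "x \<in> carrier G" for x
      using h that by (auto simp: cochain_group_def)
    have d: "\<delta> (Suc 0) h \<in> carrier (cochain_group G M 2)"
      using coboundary_hom[of "Suc 0"] h by (auto simp: hom_def numeral_2_eq_2)
    \<comment> \<open>After sorting the sum, two opposite terms can be separated by another
      summand.\<close>
    have cancel: "a \<oplus>\<^bsub>M\<^esub> (b \<oplus>\<^bsub>M\<^esub> (\<ominus>\<^bsub>M\<^esub> a \<oplus>\<^bsub>M\<^esub> c)) = b \<oplus>\<^bsub>M\<^esub> c"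
      if "a \<in> carrier M" "b \<in> carrier M" "c \<in> carrier M" for a b c
      using that by (metis M.a_inv_closed M.a_lcomm M.r_neg2 M.add.m_closed)
    show ?thesis
      unfolding coboundary_2[OF d t]
      using t t'
      by (simp add: coboundary_1[OF h] h' act_closed act_add act_neg act_mult a_minus_def M.minus_add m_assoc M.a_ac
          M.r_neg M.r_neg2 cancel cochain_group_def)
  qed (simp add: cochain_group_def coboundary_map_def)
qed

lemma cochain_pow:
  assumes "f \<in> carrier (cochain_group G M n)" "t \<in> tuples G n"
  shows "(f [^]\<^bsub>cochain_group G M n\<^esub> (k::nat)) t = [k] \<cdot>\<^bsub>M\<^esub> f t"
proof (induction k)
  case 0
  then show ?case using assms(2) by (simp add: nat_pow_def cochain_group_def)
next
  case (Suc k)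
  then show ?case using assms by (auto simp: nat_pow_def cochain_group_def)
qed

section \<open>Torsion in the second cohomology group\<close>

lemma subgroup_coboundaries_2: "subgroup (coboundaries G T M TM act 2) (cocycle_group G T M TM act 2)"
proof -
  interpret C: comm_group "cochain_group G M 2" by (rule M.comm_group_cochain_group)
  have B: "coboundaries G T M TM act 2 = \<delta> (Suc 0) ` carrier (cochain_group G M (Suc 0))"
    using coboundaries_Suc[of "Suc 0"] by (simp add: numeral_2_eq_2)
  have "subgroup (coboundaries G T M TM act 2) (cochain_group G M 2)"
    unfolding B using group_hom.img_is_subgroup[OF coboundary_group_hom[of "Suc 0"]]
    by (simp add: numeral_2_eq_2)
  moreover have "subgroup (kernel (cochain_group G M 2) (cochain_group G M (Suc 2)) (\<delta> 2)) (cochain_group G M 2)"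
    by (rule group_hom.subgroup_kernel[OF coboundary_group_hom])
  moreover have "coboundaries G T M TM act 2 \<subseteq> kernel (cochain_group G M 2) (cochain_group G M (Suc 2)) (\<delta> 2)"
  proof -
    have "\<delta> (Suc 0) \<in> carrier (cochain_group G M (Suc 0)) \<rightarrow> carrier (cochain_group G M 2)"
      using coboundary_hom[of "Suc 0"] by (simp add: hom_def numeral_2_eq_2)
    then show ?thesis using coboundary_coboundary by (auto simp: B kernel_def)
  qed
  ultimately show ?thesis unfolding cocycle_group_eq by (rule C.subgroup_incl)
qed

text \<open>The class of \<open>f\<close> is nontrivial while its \<open>k\<close>-th power is
  trivial. That power may be computed among all cochains, because the cocycle group inherits their
  multiplication.\<close>

lemma cohomology_2_torsion:
  assumes f: "f \<in> carrier (cocycle_group G T M TM act 2)" "f \<notin> coboundaries G T M TM act 2"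
    and k: "0 < k" "f [^]\<^bsub>cochain_group G M 2\<^esub> (k::nat) \<in> coboundaries G T M TM act 2"
  shows "\<not> torsion_free_group (cohomology_group G T M TM act 2)"
proof
  let ?Z = "cocycle_group G T M TM act 2" and ?B = "coboundaries G T M TM act 2"
  let ?H = "cohomology_group G T M TM act 2"
  assume *: "torsion_free_group ?H"
  interpret C: comm_group "cochain_group G M 2" by (rule M.comm_group_cochain_group)
  have sub: "subgroup (kernel (cochain_group G M 2) (cochain_group G M (Suc 2)) (\<delta> 2)) (cochain_group G M 2)"
    by (rule group_hom.subgroup_kernel[OF coboundary_group_hom])
  \<comment> \<open>Commutativity makes the coboundaries normal, so that the quotient is a
    group.\<close>
  have "comm_group ?Z"
    unfolding cocycle_group_eq
    by (rule group.group_comm_groupI[OF C.subgroup_imp_group[OF sub]])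
      (simp add: kernel_def C.m_comm)
  then interpret Z: comm_group ?Z .
  interpret B: normal ?B ?Z
    by (rule Z.subgroup_imp_normal[OF subgroup_coboundaries_2])
  have hom: "group_hom ?Z ?H (\<lambda>a. ?B #>\<^bsub>?Z\<^esub> a)"
    unfolding cohomology_group_def
    by (intro group_hom.intro group_hom_axioms.intro Z.is_group B.factorgroup_is_group B.r_coset_hom_Mod)
  have pow: "f [^]\<^bsub>?Z\<^esub> k = f [^]\<^bsub>cochain_group G M 2\<^esub> k"
    unfolding cocycle_group_eq by (simp add: nat_pow_def)
  have one: "\<one>\<^bsub>?H\<^esub> = ?B" by (simp add: cohomology_group_def FactGroup_def)
  have "(?B #>\<^bsub>?Z\<^esub> f) [^]\<^bsub>?H\<^esub> k = ?B #>\<^bsub>?Z\<^esub> (f [^]\<^bsub>?Z\<^esub> k)"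
    using group_hom.hom_nat_pow[OF hom f(1)] by simp
  also have "\<dots> = \<one>\<^bsub>?H\<^esub>"
    using k(2) unfolding pow one by (simp add: Z.coset_join2[OF _ B.subgroup_axioms] B.subset[THEN subsetD])
  finally have "?B #>\<^bsub>?Z\<^esub> f = \<one>\<^bsub>?H\<^esub>"
    using * k(1) group_hom.hom_closed[OF hom f(1)] by (auto simp: torsion_free_group_def)
  \<comment> \<open>A coset contains its representative, so a trivial class would put
    \<open>f\<close> among the coboundaries.\<close>
  then show False
    using f B.subgroup_axioms Z.rcos_self[of f ?B] by (simp add: one)
qed

end

section \<open>The carry cocycle of a cyclic group\<close>

text \<open>Both sides are the total carry \<open>(i + j + k) div p\<close> of adding three numbers,
  bracketed in two ways. This is the 2-cocycle identity for carrying.\<close>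

lemma carry_cocycle:
  fixes i j k p :: nat
  shows "(i + j) div p + ((i + j) mod p + k) div p = (j + k) div p + (i + (j + k) mod p) div p"
proof (cases "p = 0")
  case False
  have "a div p + (a mod p + b) div p = (a + b) div p" for a b
  proof -
    have "a + b = p * (a div p) + (a mod p + b)" by simp
    then show ?thesis using False by (metis add.commute div_mult_self2)
  qed
  from this[of "i + j" k] this[of "j + k" i] show ?thesis by (simp add: ac_simps)
qed simp

text \<open>The carry cocycle is not a coboundary, yet \<open>p\<close> times it is the differential
  of the discrete logarithm. Its class is therefore nonzero and killed by \<open>p\<close>.\<close>

lemma cyclic_group_H2_torsion:
  assumes p: "1 < p"
    and D: "finite_group_module D (Zp p) T (Zp_topology p) act"
    and act: "\<And>x a. x \<in> carrier D \<Longrightarrow> a \<in> carrier (Zp p) \<Longrightarrow> act x a = a"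
    and g: "g \<in> carrier D" "carrier D = (\<lambda>i. g [^]\<^bsub>D\<^esub> i) ` {..<p}"
      "inj_on (\<lambda>i. g [^]\<^bsub>D\<^esub> i) {..<p}" "g [^]\<^bsub>D\<^esub> p = \<one>\<^bsub>D\<^esub>"
  shows "\<not> torsion_free_group (cohomology_group D T (Zp p) (Zp_topology p) act 2)"
proof -
  interpret finite_group_module D "Zp p" T "Zp_topology p" act by (rule D)
  have p0: "0 < p" using p by simp
  \<comment> \<open>The discrete logarithm to base \<open>g\<close>, with values below
    \<open>p\<close>.\<close>
  define L where "L = inv_into {..<p} (\<lambda>i. g [^]\<^bsub>D\<^esub> i)"
  have L_pow: "L (g [^]\<^bsub>D\<^esub> i) = i" if "i < p" for i
    unfolding L_def using g(3) that by (simp add: inv_into_f_f)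
  have pow_L: "g [^]\<^bsub>D\<^esub> L x = x" "L x < p" if "x \<in> carrier D" for x
    using that f_inv_into_f[of x "\<lambda>i. g [^]\<^bsub>D\<^esub> i" "{..<p}"] inv_into_into[of x "\<lambda>i. g [^]\<^bsub>D\<^esub> i" "{..<p}"]
    by (auto simp: L_def g(2))
  have L_mult: "L (x \<otimes>\<^bsub>D\<^esub> y) = (L x + L y) mod p" if xy: "x \<in> carrier D" "y \<in> carrier D" for x y
  proof -
    let ?n = "L x + L y"
    have "x \<otimes>\<^bsub>D\<^esub> y = g [^]\<^bsub>D\<^esub> ?n" using xy g(1) pow_L(1) by (simp flip: nat_pow_mult)
    also have "\<dots> = g [^]\<^bsub>D\<^esub> (p * (?n div p) + ?n mod p)" by simp
    also have "\<dots> = (g [^]\<^bsub>D\<^esub> p) [^]\<^bsub>D\<^esub> (?n div p) \<otimes>\<^bsub>D\<^esub> g [^]\<^bsub>D\<^esub> (?n mod p)"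
      using g(1) by (simp only: nat_pow_mult[symmetric] nat_pow_pow)
    also have "\<dots> = g [^]\<^bsub>D\<^esub> (?n mod p)" using g(1,4) by simp
    finally show ?thesis using L_pow p0 by simp
  qed
  \<comment> \<open>The carry, 0 or 1, in adding the two exponents.\<close>
  define f where "f = (\<lambda>t\<in>tuples D 2. Zp_of_int p (int ((L (t 0) + L (t 1)) div p)))"
  have f_pair: "f (pair_tuple x y) = Zp_of_int p (int ((L x + L y) div p))"
    if "x \<in> carrier D" "y \<in> carrier D" for x y
    using pair_tuple_in[OF that] by (simp add: f_def) (simp add: pair_tuple_def)
  have f: "f \<in> carrier (cochain_group D (Zp p) 2)"
    by (auto simp: f_def cochain_group_def Zp_of_int_closed p0)
  have "\<delta> 2 f = \<one>\<^bsub>cochain_group D (Zp p) 3\<^esub>"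
  proof
    fix t
    show "\<delta> 2 f t = \<one>\<^bsub>cochain_group D (Zp p) 3\<^esub> t"
    proof (cases "t \<in> tuples D 3")
      case t: True
      have t': "t 0 \<in> carrier D" "t 1 \<in> carrier D" "t 2 \<in> carrier D" using t by (auto intro: tuples_nth)
      \<comment> \<open>With trivial action the differential of \<open>f\<close> is this alternating
        sum of carries.\<close>
      have "int ((L (t 1) + L (t 2)) div p) - int (((L (t 0) + L (t 1)) mod p + L (t 2)) div p)
          + int ((L (t 0) + (L (t 1) + L (t 2)) mod p) div p) - int ((L (t 0) + L (t 1)) div p) = 0"
        using carry_cocycle[of "L (t 0)" "L (t 1)" p "L (t 2)"] by linarith
      then show ?thesis
        unfolding coboundary_2[OF f t]
        using t t' by (simp add: f_pair act L_mult Zp_of_int_closed p0 Zp_of_int_diff Zp_of_int_add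
            cochain_group_def Zp_zero)
    qed (simp add: cochain_group_def coboundary_map_def)
  qed
  then have cocycle: "f \<in> carrier (cocycle_group D T (Zp p) (Zp_topology p) act 2)"
    using f by (simp add: cocycle_group_eq kernel_def)
  have B: "coboundaries D T (Zp p) (Zp_topology p) act 2 = \<delta> (Suc 0) ` carrier (cochain_group D (Zp p) (Suc 0))"
    using coboundaries_Suc[of "Suc 0"] by (simp add: numeral_2_eq_2)
  have "f \<notin> coboundaries D T (Zp p) (Zp_topology p) act 2"
  proof
    assume "f \<in> coboundaries D T (Zp p) (Zp_topology p) act 2"
    then obtain h where h: "h \<in> carrier (cochain_group D (Zp p) (Suc 0))" "f = \<delta> (Suc 0) h"
      unfolding B by blast
    \<comment> \<open>Modulo \<open>p\<close>, such an \<open>h\<close> is additive until the first carry, which occurs at \<open>g\<^sup>p = 1\<close>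
      and then forces \<open>1 = p * h g\<close>.\<close>
    define H where "H x = h (single_tuple x) 1" for x
    have h': "h (single_tuple x) \<in> carrier (Zp p)" if "x \<in> carrier D" for x
      using h(1) that by (auto simp: cochain_group_def)
    have H: "[int ((L x + L y) div p) = H y - H (x \<otimes>\<^bsub>D\<^esub> y) + H x] (mod int p)"
      if "x \<in> carrier D" "y \<in> carrier D" for x y
    proof -
      have "Zp_of_int p (int ((L x + L y) div p)) 1
          = (h (single_tuple y) \<ominus>\<^bsub>Zp p\<^esub> h (single_tuple (x \<otimes>\<^bsub>D\<^esub> y)) \<oplus>\<^bsub>Zp p\<^esub> h (single_tuple x)) 1"
        using f_pair[OF that] coboundary_1[OF h(1) that] that by (simp add: h(2) act h')
      also have "\<dots> = (H y - H (x \<otimes>\<^bsub>D\<^esub> y) + H x) mod int p"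
        using that p0 h'[of "x \<otimes>\<^bsub>D\<^esub> y"]
        by (simp add: a_minus_def Zp_add_component Zp_minus_component H_def mod_simps)
      finally show ?thesis by (simp add: cong_def Zp_of_int_def)
    qed
    have L1: "L \<one>\<^bsub>D\<^esub> = 0" using L_pow[of 0] p0 by simp
    have Lg: "L g = 1" using L_pow[of 1] p g(1) by simp
    \<comment> \<open>At the pair of two identities there is no carry, and the relation reduces to 0
      = H(1).\<close>
    have H1: "[H \<one>\<^bsub>D\<^esub> = 0] (mod int p)"
      using H[of "\<one>\<^bsub>D\<^esub>" "\<one>\<^bsub>D\<^esub>"] by (simp add: L1 cong_sym_eq)
    have Hpow: "[H (g [^]\<^bsub>D\<^esub> j) = int j * H g] (mod int p)" if "j < p" for j
      using that
    proof (induction j)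
      case 0
      then show ?case using H1 by simp
    next
      case (Suc j)
      have "[0 = H g - H (g [^]\<^bsub>D\<^esub> Suc j) + H (g [^]\<^bsub>D\<^esub> j)] (mod int p)"
        using H[of "g [^]\<^bsub>D\<^esub> j" g] g(1) Suc.prems by (simp add: L_pow Lg)
      then have "[H (g [^]\<^bsub>D\<^esub> Suc j) = H g + H (g [^]\<^bsub>D\<^esub> j)] (mod int p)"
        by (simp add: cong_iff_dvd_diff algebra_simps)
      also have "[H g + H (g [^]\<^bsub>D\<^esub> j) = H g + int j * H g] (mod int p)"
        using Suc by (intro cong_add) auto
      finally show ?case by (simp add: algebra_simps)
    qed
    \<comment> \<open>\<open>m\<close> is p - 1, the exponent at which multiplying by
      \<open>g\<close> first carries.\<close>
    obtain m where m: "p = Suc m" using p0 gr0_implies_Suc by blast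
    have "g [^]\<^bsub>D\<^esub> m \<otimes>\<^bsub>D\<^esub> g = \<one>\<^bsub>D\<^esub>" using g(4) by (simp add: m)
    then have "[1 = H g - H \<one>\<^bsub>D\<^esub> + H (g [^]\<^bsub>D\<^esub> m)] (mod int p)"
      using H[of "g [^]\<^bsub>D\<^esub> m" g] g(1) L_pow[of m] p0 by (simp add: Lg m)
    also have "[H g - H \<one>\<^bsub>D\<^esub> + H (g [^]\<^bsub>D\<^esub> m) = H g - 0 + int m * H g] (mod int p)"
      by (intro cong_add cong_diff cong_refl H1 Hpow) (simp add: m)
    also have "H g - 0 + int m * H g = int p * H g" by (simp add: m algebra_simps)
    also have "[int p * H g = 0] (mod int p)" by (simp add: cong_def)
    finally show False using p by (simp add: cong_def)
  qed
  moreover have "f [^]\<^bsub>cochain_group D (Zp p) 2\<^esub> p \<in> coboundaries D T (Zp p) (Zp_topology p) act 2"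
  proof -
    \<comment> \<open>The logarithm as an integer-valued cochain: its differential at
      \<open>x\<close>, \<open>y\<close> is L(x) + L(y) - L(xy), which is \<open>p\<close> times the
      carry.\<close>
    define h where "h = (\<lambda>t\<in>tuples D (Suc 0). Zp_of_int p (int (L (t 0))))"
    have h: "h \<in> carrier (cochain_group D (Zp p) (Suc 0))"
      by (auto simp: h_def cochain_group_def Zp_of_int_closed p0)
    have h_single: "h (single_tuple x) = Zp_of_int p (int (L x))" if "x \<in> carrier D" for x
      using single_tuple_in[OF that] by (simp add: h_def) (simp add: single_tuple_def)
    have d: "\<delta> (Suc 0) h \<in> carrier (cochain_group D (Zp p) 2)"
      using coboundary_hom[of "Suc 0"] h by (auto simp: hom_def numeral_2_eq_2)
    interpret C: comm_group "cochain_group D (Zp p) 2" by (rule M.comm_group_cochain_group)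
    have fp: "f [^]\<^bsub>cochain_group D (Zp p) 2\<^esub> p \<in> carrier (cochain_group D (Zp p) 2)"
      using f by simp
    have "f [^]\<^bsub>cochain_group D (Zp p) 2\<^esub> p = \<delta> (Suc 0) h"
    proof (rule extensionalityI[of _ "tuples D 2"])
      fix t assume t: "t \<in> tuples D 2"
      then have t': "t 0 \<in> carrier D" "t 1 \<in> carrier D" by (auto intro: tuples_nth)
      let ?n = "L (t 0) + L (t 1)"
      have eq: "int p * int (?n div p) = int (L (t 1)) - int (?n mod p) + int (L (t 0))"
      proof -
        have "int p * int (?n div p) + int (?n mod p) = int ?n"
          by (metis mult_div_mod_eq of_nat_add of_nat_mult)
        then show ?thesis by simp
      qed
      have "(f [^]\<^bsub>cochain_group D (Zp p) 2\<^esub> p) t = Zp_of_int p (int p * int (?n div p))"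
        using cochain_pow[OF f t, of p] t by (simp add: f_def Zp_of_int_add_pow)
      also have "\<dots> = \<delta> (Suc 0) h (pair_tuple (t 0) (t 1))"
        unfolding eq coboundary_1[OF h t']
        using t' by (simp add: h_single act Zp_of_int_closed p0 L_mult Zp_of_int_diff Zp_of_int_add)
      finally show "(f [^]\<^bsub>cochain_group D (Zp p) 2\<^esub> p) t = \<delta> (Suc 0) h t"
        using tuples_2[OF t] by simp
    qed (use fp d in \<open>auto simp: cochain_group_def PiE_iff\<close>)
    then show ?thesis unfolding B using h by blast
  qed
  ultimately show ?thesis using cohomology_2_torsion[OF cocycle _ p0] by blast
qed

section \<open>Torsion in groups with a cyclotomic orientation\<close>

text \<open>The order of \<open>g\<close> divides the prime \<open>p\<close> and is not 1, so it
  equals \<open>p\<close>; the exponents below \<open>p\<close> then enumerate the subgroup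
  generated by \<open>g\<close> without repetition.\<close>

lemma (in group) prime_ord_powers:
  fixes p :: nat
  assumes p: "prime p" and g: "g \<in> carrier G" "g [^] p = \<one>" "g \<noteq> \<one>"
  shows "subgroup ((\<lambda>i. g [^] i) ` {..<p}) G" and "inj_on (\<lambda>i. g [^] i) {..<p}"
proof -
  have "ord g dvd p" using g(1,2) by (simp add: pow_eq_id)
  then have ord: "ord g = p" using p g(1,3) ord_eq_1 by (metis prime_nat_iff)
  have p0: "0 < p" using p by (rule prime_gt_0_nat)
  then have dom: "{..<p} = {0..ord g - 1}" using ord by auto
  show "inj_on (\<lambda>i. g [^] i) {..<p}" unfolding dom by (rule ord_inj[OF g(1)])
  have "ord g \<noteq> 0" using ord p0 by simp
  then have "(\<lambda>i. g [^] i) ` {..<p} = generate G {g}"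
    unfolding dom using generate_pow_nat[OF g(1)] ord_elems_inf_carrier[OF g(1)] by auto
  then show "subgroup ((\<lambda>i. g [^] i) ` {..<p}) G" using g(1) by (simp add: generate_is_subgroup)
qed

locale cyclotomic_group = group G for G :: "('g, 'b) monoid_scheme" (structure) +
  fixes p :: nat and T :: "'g topology" and \<theta> :: "'g \<Rightarrow> nat \<Rightarrow> int"
  assumes prime: "prime p" and cyclotomic: "cyclotomic_orientation p G T \<theta>"
begin

section \<open>Basic properties of the orientation\<close>

lemma Hausdorff: "Hausdorff_space T" and topspace: "topspace T = carrier G"
proof -
  have "pro_p_group p G T"
    using cyclotomic by (simp add: cyclotomic_orientation_def bloch_kato_pro_p_group_def)
  then show "Hausdorff_space T" "topspace T = carrier G"
    by (simp_all add: pro_p_group_def profinite_group_def topological_group_def)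
qed

lemma \<theta>_hom: "\<theta> \<in> hom G (units_of (Zp p))"
  using cyclotomic by (simp add: cyclotomic_orientation_def orientation_def)

lemma \<theta>_mult: "x \<in> carrier G \<Longrightarrow> y \<in> carrier G \<Longrightarrow> \<theta> (x \<otimes> y) = \<theta> x \<otimes>\<^bsub>Zp p\<^esub> \<theta> y"
  using \<theta>_hom by (simp add: hom_def units_of_def)

lemma \<theta>_group_hom: "group_hom G (units_of (Zp p)) \<theta>"
proof -
  interpret Z: cring "Zp p" by (rule Zp_cring[OF prime_gt_0_nat[OF prime]])
  show ?thesis
    using \<theta>_hom Z.units_group by (simp add: group_hom_def group_hom_axioms_def)
qed

lemma \<theta>_closed: "x \<in> carrier G \<Longrightarrow> \<theta> x \<in> carrier (Zp p)"
  using \<theta>_hom by (auto simp: hom_def units_of_def Units_def)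

lemma \<theta>_pow: "x \<in> carrier G \<Longrightarrow> \<theta> (x [^] (n::nat)) = \<theta> x [^]\<^bsub>units_of (Zp p)\<^esub> n"
  using group_hom.hom_nat_pow[OF \<theta>_group_hom] .

lemma \<theta>_one: "\<theta> \<one> = \<one>\<^bsub>Zp p\<^esub>"
  using group_hom.hom_one[OF \<theta>_group_hom] by (simp add: units_of_def)

text \<open>Here torsion-freeness enters. A nontrivial \<open>g\<close> would generate a subgroup of
  order \<open>p\<close>, closed because it is finite in a Hausdorff space, and acting trivially on
  the coefficients; its second cohomology group has torsion.\<close>

lemma eq_one_if_\<theta>_eq_one:
  assumes g: "g \<in> carrier G" "g [^] p = \<one>" and \<theta>: "\<theta> g = \<one>\<^bsub>Zp p\<^esub>"
  shows "g = \<one>"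
proof (rule ccontr)
  assume "g \<noteq> \<one>"
  define C where "C = (\<lambda>i. g [^] i) ` {..<p}"
  have C: "subgroup C G" "inj_on (\<lambda>i. g [^] i) {..<p}"
    using prime_ord_powers[OF prime g \<open>g \<noteq> \<one>\<close>] by (simp_all add: C_def)
  have CG: "C \<subseteq> carrier G" using C(1) by (rule subgroup.subset)
  have fin: "finite C" by (simp add: C_def)
  let ?D = "G\<lparr>carrier := C\<rparr>" and ?act = "\<lambda>g a. \<theta> g \<otimes>\<^bsub>Zp p\<^esub> a"
  interpret Z: cring "Zp p" by (rule Zp_cring[OF prime_gt_0_nat[OF prime]])
  \<comment> \<open>Since \<theta> is 1 at \<open>g\<close>, it is 1 at every power of
    \<open>g\<close>, that is on all of \<open>C\<close>.\<close>
  have act: "?act x a = a" if "x \<in> C" "a \<in> carrier (Zp p)" for x a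
  proof -
    obtain i :: nat where "x = g [^] i" using \<open>x \<in> C\<close> by (auto simp: C_def)
    then have "\<theta> x = \<one>\<^bsub>units_of (Zp p)\<^esub> [^]\<^bsub>units_of (Zp p)\<^esub> i"
      using \<theta> \<theta>_pow[OF g(1)] by (simp add: units_of_def)
    then have "\<theta> x = \<one>\<^bsub>Zp p\<^esub>"
      using monoid.nat_pow_one[OF group.is_monoid[OF Z.units_group], of i] by (simp add: units_of_def)
    then show ?thesis using that by simp
  qed
  have "finite_group_module ?D (Zp p) (subtopology T C) (Zp_topology p) ?act"
    using fin C(1) CG
    by (intro finite_group_module.intro finite_group_module_axioms.intro subgroup_imp_group Z.abelian_group_axioms)
      (auto simp: Hausdorff Hausdorff_space_subtopology topspace Zp_topology_def act subgroup.m_closed)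
  then have "\<not> torsion_free_group (Zp1_cohomology p ?D (subtopology T C) \<theta> 2)"
    unfolding Zp1_cohomology_def
  proof (rule cyclic_group_H2_torsion[OF prime_gt_1_nat[OF prime]])
    have "g [^] (1::nat) \<in> C" unfolding C_def using prime_gt_1_nat[OF prime] by blast
    then show "g \<in> carrier ?D" using g(1) by simp
  qed (use C(2) g(2) act in \<open>simp_all add: C_def flip: nat_pow_consistent\<close>)
  moreover have "closed_subgroup C G T"
    using C(1) fin CG Hausdorff topspace by (simp add: closed_subgroup_def closedin_Hausdorff_finite)
  ultimately show False using cyclotomic by (simp add: cyclotomic_orientation_def)
qed

text \<open>The value \<open>\<theta> g\<close> is a p-th root of unity, and the side condition
  leaves only 1. For \<open>p = 2\<close> it asks that \<open>\<theta> g\<close> be 1 modulo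
  4.\<close>

lemma eq_one_if_pow_p_eq_one:
  assumes "g \<in> carrier G" "g [^] p = \<one>" "odd p \<or> \<theta> g 2 = 1"
  shows "g = \<one>"
proof -
  have "\<theta> g [^]\<^bsub>units_of (Zp p)\<^esub> p = \<one>\<^bsub>Zp p\<^esub>"
    using assms(2) \<theta>_pow[OF assms(1), of p] \<theta>_one by simp
  then show ?thesis
    by (rule eq_one_if_\<theta>_eq_one[OF assms(1,2) Zp_pow_p_eq_one[OF prime \<theta>_closed[OF assms(1)] _ assms(3)]])
qed

text \<open>Peel off one factor \<open>p\<close> at a time: if \<open>p ^ Suc k\<close> kills
  \<open>g\<close>, then \<open>g [^] (p ^ k)\<close> is killed by \<open>p\<close>, hence
  trivial.\<close>

lemma no_p_torsionI:
  assumes "\<And>g. \<lbrakk>g \<in> carrier G; g [^] p = \<one>\<rbrakk> \<Longrightarrow> g = \<one>"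
  shows "no_p_torsion p G"
proof -
  have "g = \<one>" if "g \<in> carrier G" "g [^] (p ^ k) = \<one>" for g k
    using that
  proof (induction k)
    case (Suc k)
    have *: "(g [^] (p ^ k)) [^] p = \<one>"
      using Suc.prems by (simp add: nat_pow_pow mult.commute)
    have "g [^] (p ^ k) = \<one>" by (rule assms[OF nat_pow_closed[OF Suc.prems(1)] *])
    with Suc show ?case by blast
  qed simp
  then have "p_torsion_elements p G \<subseteq> {\<one>}"
    unfolding p_torsion_elements_def by blast
  then show ?thesis by (auto simp: no_p_torsion_def p_torsion_elements_def)
qed

section \<open>The case p = 2\<close>

text \<open>Component 2 is the residue modulo 4, where 0 and 2 are not invertible. The remaining
  values 1 and 3 act as a sign.\<close>

lemma \<theta>_component_2:
  assumes "p = 2" "x \<in> carrier G"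
  shows "\<theta> x 2 = 1 \<or> \<theta> x 2 = 3"
proof -
  have "\<theta> (x \<otimes> inv x) = \<theta> x \<otimes>\<^bsub>Zp p\<^esub> \<theta> (inv x)"
    using assms(2) by (intro \<theta>_mult) simp_all
  then have "\<theta> x \<otimes>\<^bsub>Zp p\<^esub> \<theta> (inv x) = \<theta> \<one>" using assms(2) by simp
  then have "(\<theta> x \<otimes>\<^bsub>Zp p\<^esub> \<theta> (inv x)) 2 = 1" using assms(1) by (simp add: \<theta>_one Zp_one)
  then have *: "(\<theta> x 2 * \<theta> (inv x) 2) mod 4 = 1" using assms(1) by (simp add: Zp_def)
  have "\<theta> x 2 \<in> {0..<int p ^ 2}" using \<theta>_closed[OF assms(2)] by (simp add: Zp_def)
  then have "0 \<le> \<theta> x 2" "\<theta> x 2 < 4" using assms(1) by simp_all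
  then consider "\<theta> x 2 = 0" | "\<theta> x 2 = 1" | "\<theta> x 2 = 2" | "\<theta> x 2 = 3" by linarith
  then show ?thesis using * by cases (simp_all, presburger)
qed

text \<open>Equal signs multiply to 1, since 3 times 3 is 9. With \<open>x = y\<close> this covers
  squares.\<close>

lemma \<theta>_mult_component_2:
  assumes "p = 2" "x \<in> carrier G" "y \<in> carrier G" "\<theta> x 2 = \<theta> y 2"
  shows "\<theta> (x \<otimes> y) 2 = 1"
proof -
  have "\<theta> (x \<otimes> y) 2 = (\<theta> x 2 * \<theta> y 2) mod 4"
    using assms(1) by (simp add: \<theta>_mult assms(2,3) Zp_def)
  then show ?thesis using \<theta>_component_2[OF assms(1,2)] assms(4) by auto
qed

text \<open>No element has order 4: a square has sign 1, so a square that itself squares to 1 is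
  trivial. This lowers the exponent \<open>2 ^ k\<close> step by step down to 2.\<close>

lemma p_torsion_square_eq_one:
  assumes "p = 2" "g \<in> carrier G" "g [^] (2 ^ k :: nat) = \<one>"
  shows "g \<otimes> g = \<one>"
  using assms(3)
proof (induction k)
  case (Suc k)
  show ?case
  proof (cases k)
    case (Suc j)
    \<comment> \<open>The square of \<open>?h\<close> is \<open>g [^] (2 ^ k)\<close>, and squaring
      once more gives \<open>g [^] (2 ^ Suc k)\<close>, which is trivial.\<close>
    let ?h = "g [^] (2 ^ j :: nat)"
    have h: "?h \<in> carrier G" using assms(2) by simp
    have "(?h \<otimes> ?h) [^] p = g [^] (2 ^ Suc k :: nat)"
      using assms(1,2) by (simp add: nat_pow_mult nat_pow_pow Suc flip: mult_2)
    with Suc.prems have "?h \<otimes> ?h = \<one>"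
      using \<theta>_mult_component_2[OF assms(1) h h refl] h by (intro eq_one_if_pow_p_eq_one[of "?h \<otimes> ?h"]) auto
    moreover have "?h \<otimes> ?h = g [^] (2 ^ k :: nat)"
      using assms(2) by (simp add: nat_pow_mult Suc mult_2)
    ultimately show ?thesis using Suc.IH by simp
  qed (use Suc.prems assms(2) in \<open>simp add: numeral_2_eq_2\<close>)
qed (use assms(2) in simp)

text \<open>An involution of sign 1 would be trivial, so \<open>a\<close> and \<open>b\<close> both
  have sign 3. Their product has sign 1 and squares to 1, hence is trivial, and \<open>b\<close> is
  the inverse of \<open>a\<close>, which is \<open>a\<close>.\<close>

lemma involution_unique:
  assumes "p = 2" and a: "a \<in> carrier G" "a \<noteq> \<one>" "a \<otimes> a = \<one>"
    and b: "b \<in> carrier G" "b \<noteq> \<one>" "b \<otimes> b = \<one>" and ab: "(a \<otimes> b) \<otimes> (a \<otimes> b) = \<one>"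
  shows "b = a"
proof -
  have pow: "x [^] p = x \<otimes> x" if "x \<in> carrier G" for x
    using that assms(1) by (simp add: numeral_2_eq_2)
  have "\<theta> x 2 = 3" if "x \<in> carrier G" "x \<noteq> \<one>" "x \<otimes> x = \<one>" for x
    using \<theta>_component_2[OF assms(1) that(1)] eq_one_if_pow_p_eq_one[OF that(1)] pow[OF that(1)] that(2,3)
    by auto
  from this[OF a] this[OF b] have "\<theta> a 2 = \<theta> b 2" by simp
  then have "\<theta> (a \<otimes> b) 2 = 1" using \<theta>_mult_component_2[OF assms(1)] a(1) b(1) by blast
  then have "a \<otimes> b = \<one>"
    using pow[of "a \<otimes> b"] a(1) b(1) ab by (intro eq_one_if_pow_p_eq_one[of "a \<otimes> b"]) simp_all
  then have "a \<otimes> b = a \<otimes> a" using a(3) by simp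
  then show ?thesis using a(1) b(1) by simp
qed

text \<open>Every element of \<open>H\<close> squares to 1, so two nontrivial ones must coincide and
  \<open>H\<close> has exactly two elements.\<close>

lemma torsion_subgroup_iso:
  assumes p: "p = 2" and H: "subgroup H G" "H \<noteq> {\<one>}" "p_torsion_group 2 (G\<lparr>carrier := H\<rparr>)"
  shows "G\<lparr>carrier := H\<rparr> \<cong> integer_mod_group 2"
proof -
  have HG: "H \<subseteq> carrier G" using H(1) by (rule subgroup.subset)
  have one: "\<one> \<in> H" using H(1) by (rule subgroup.one_closed)
  have sq: "x \<otimes> x = \<one>" if "x \<in> H" for x
  proof -
    have "x \<in> p_torsion_elements 2 (G\<lparr>carrier := H\<rparr>)"
      using H(3) that by (simp add: p_torsion_group_def)
    then obtain k where "x [^] (2 ^ k :: nat) = \<one>"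
      by (auto simp: p_torsion_elements_def simp flip: nat_pow_consistent)
    then show ?thesis using p_torsion_square_eq_one[OF p] HG that by blast
  qed
  obtain a where a: "a \<in> H" "a \<noteq> \<one>" using H(2) one by blast
  \<comment> \<open>The product of \<open>a\<close> and \<open>b\<close> lies in \<open>H\<close>
    again, so \<open>sq\<close> also provides the condition on its square.\<close>
  have "b = a" if "b \<in> H" "b \<noteq> \<one>" for b
    using HG a that by (intro involution_unique[OF p _ a(2)] sq subgroup.m_closed[OF H(1)]) auto
  then have Heq: "H = {\<one>, a}" using a one by blast
  have aa: "a \<in> carrier G" "a \<otimes> a = \<one>" using a(1) HG sq by auto
  have two: "{0..<2} = {0, 1::int}" by auto
  have "(\<lambda>x. if x = \<one> then 0 else 1) \<in> iso (G\<lparr>carrier := H\<rparr>) (integer_mod_group 2)"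
    unfolding iso_def hom_def Heq bij_betw_def inj_on_def carrier_integer_mod_group
    using a(2) aa by (simp add: two)
  then show ?thesis by (auto simp: is_iso_def)
qed

text \<open>If \<open>g\<close> squares to 1, its image under \<theta> is 2-torsion in the image
  group, hence 1, which puts \<open>g\<close> in the kernel of \<theta>.\<close>

lemma no_2_torsion_if_image_no_2_torsion:
  assumes p: "p = 2" and im: "no_p_torsion 2 ((units_of (Zp 2))\<lparr>carrier := \<theta> ` carrier G\<rparr>)"
  shows "no_p_torsion 2 G"
proof -
  let ?I = "(units_of (Zp 2))\<lparr>carrier := \<theta> ` carrier G\<rparr>"
  have "g = \<one>" if g: "g \<in> carrier G" "g [^] p = \<one>" for g
  proof -
    \<comment> \<open>The exponent 2 is written \<open>2 ^ 1\<close> to match the form used in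
      \<open>p_torsion_elements\<close>.\<close>
    have "\<theta> g [^]\<^bsub>units_of (Zp 2)\<^esub> (2 ^ 1 :: nat) = \<one>\<^bsub>units_of (Zp 2)\<^esub>"
      using \<theta>_pow[OF g(1), of p] g(2) \<theta>_one p by (simp add: units_of_def)
    then have "\<theta> g [^]\<^bsub>?I\<^esub> (2 ^ 1 :: nat) = \<one>\<^bsub>?I\<^esub>"
      by (simp add: nat_pow_def)
    then have "\<exists>k::nat. \<theta> g [^]\<^bsub>?I\<^esub> (2 ^ k :: nat) = \<one>\<^bsub>?I\<^esub>" by blast
    then have "\<theta> g \<in> p_torsion_elements 2 ?I"
      using g(1) by (simp add: p_torsion_elements_def)
    then have "\<theta> g = \<one>\<^bsub>Zp p\<^esub>" using im p by (simp add: no_p_torsion_def units_of_def)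
    then show ?thesis using eq_one_if_\<theta>_eq_one g by blast
  qed
  then show ?thesis using no_p_torsionI p by blast
qed

end

theorem corollary2p14:
  fixes p :: nat and G :: "('g, 'b) monoid_scheme" and T :: "'g topology"
    and \<theta> :: "'g \<Rightarrow> nat \<Rightarrow> int"
  assumes "prime p"
    and "pro_p_group p G T"
    and "cyclotomic_orientation p G T \<theta>"
  shows "(odd p \<longrightarrow> no_p_torsion p G) \<and>
    (p = 2 \<longrightarrow>
      (\<forall>H. closed_subgroup H G T \<and> H \<noteq> {\<one>\<^bsub>G\<^esub>} \<and> p_torsion_group 2 (G\<lparr>carrier := H\<rparr>) \<longrightarrow>
           G\<lparr>carrier := H\<rparr> \<cong> integer_mod_group 2) \<and>
      (no_p_torsion 2 ((units_of (Zp 2))\<lparr>carrier := \<theta> ` carrier G\<rparr>) \<longrightarrow> no_p_torsion 2 G))"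
proof -
  interpret cyclotomic_group G p T \<theta>
    using assms by (simp add: cyclotomic_group_def cyclotomic_group_axioms_def pro_p_group_def
        profinite_group_def topological_group_def)
  show ?thesis
  proof (intro conjI impI allI)
    assume "odd p"
    then show "no_p_torsion p G"
      by (intro no_p_torsionI) (rule eq_one_if_pow_p_eq_one, auto)
  next
    fix H assume "p = 2" "closed_subgroup H G T \<and> H \<noteq> {\<one>\<^bsub>G\<^esub>} \<and> p_torsion_group 2 (G\<lparr>carrier := H\<rparr>)"
    then show "G\<lparr>carrier := H\<rparr> \<cong> integer_mod_group 2"
      unfolding closed_subgroup_def by (intro torsion_subgroup_iso) blast+
  next
    assume "p = 2" "no_p_torsion 2 ((units_of (Zp 2))\<lparr>carrier := \<theta> ` carrier G\<rparr>)"
    then show "no_p_torsion 2 G" by (rule no_2_torsion_if_image_no_2_torsion)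
  qed
qed

end
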